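(* Let $k$ be a field of characteristic not $2$, let $\mathfrak C$ be an octonion algebra over $k$, let $G=\mathrm{Aut}(\mathfrak C)$, and let $t_0\in G(k)$ be semisimple. Then either $t_0$ leaves a quaternion subalgebra of $\mathfrak C$ invariant, or $t_0$ fixes a quadratic étale subalgebra $L$ of $\mathfrak C$ pointwise. In the latter case, $t_0$ lies in the subgroup $G(\mathfrak C/L)\subset G(k)$ of automorphisms fixing $L$ pointwise, which is isomorphic to $SU(V,h)$ for a rank $3$ hermitian space $(V,h)$ over the quadratic field extension $L$ of $k$ (if $L$ is a field), or to $SL(3)$ over $k$ (if $L\cong k\times k$).
   Context: A composition algebra over $k$ is a unital (not necessarily associative) $k$-algebra with a nondegenerate quadratic form $N$ (the norm) satisfying $N(xy)=N(x)N(y)$; octonion algebras are those of dimension $8$, quaternion algebras those of dimension $4$, and quadratic étale algebras those of dimension $2$. A quaternion (resp. quadratic étale) subalgebra of $\mathfrak C$ is a subalgebra of dimension $4$ (resp. $2$) containing $1$ on which $N$ is nondegenerate. A quadratic étale algebra is either a quadratic field extension of $k$ or isomorphic to $k\times k$. A group of type $G_2$ over $k$ is $\mathrm{Aut}(\mathfrak C)$ for an octonion algebra $\mathfrak C$. *)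

theory Defs
  imports
    "Jordan_Normal_Form.Determinant"
    "Jordan_Normal_Form.Missing_VectorSpace"
    "HOL-Algebra.Algebraic_Closure_Type"
    "HOL-Algebra.Bij"
begin

section \<open>Composition algebras\<close>

text \<open>
  The base field is the type \<open>'k\<close> and the whole type \<open>'c\<close> is the underlying set of the algebra;
  \<open>scale\<close>, \<open>pr\<close>, \<open>e\<close> and \<open>N\<close> are its scalar multiplication, product, unit and norm.  Subalgebras
  are subsets of \<open>'c\<close>.
\<close>

definition polar :: "('c::ab_group_add \<Rightarrow> 'k::field) \<Rightarrow> 'c \<Rightarrow> 'c \<Rightarrow> 'k" where
  "polar N x y = N (x + y) - N x - N y"

definition quadratic_form ::
    "('k::field \<Rightarrow> 'c::ab_group_add \<Rightarrow> 'c) \<Rightarrow> ('c \<Rightarrow> 'k) \<Rightarrow> bool" where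
  "quadratic_form scale N \<longleftrightarrow>
     (\<forall>a x. N (scale a x) = a\<^sup>2 * N x) \<and>
     (\<forall>y. Vector_Spaces.linear scale (*) (\<lambda>x. polar N x y))"

text \<open>Nondegeneracy of the polar form; this is the usual notion in characteristic not 2.\<close>

definition nondegenerate_on :: "('c::ab_group_add \<Rightarrow> 'k::field) \<Rightarrow> 'c set \<Rightarrow> bool" where
  "nondegenerate_on N S \<longleftrightarrow> (\<forall>x\<in>S. (\<forall>y\<in>S. polar N x y = 0) \<longrightarrow> x = 0)"

locale composition_algebra = vector_space scale
  for scale :: "'k::field \<Rightarrow> 'c::ab_group_add \<Rightarrow> 'c" +
  fixes pr :: "'c \<Rightarrow> 'c \<Rightarrow> 'c" and e :: 'c and N :: "'c \<Rightarrow> 'k"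
  assumes linear_left: "Vector_Spaces.linear scale scale (\<lambda>x. pr x y)"
    and linear_right: "Vector_Spaces.linear scale scale (\<lambda>y. pr x y)"
    and unit_left: "pr e x = x"
    and unit_right: "pr x e = x"
    and norm_quadratic: "quadratic_form scale N"
    and norm_nondegenerate: "nondegenerate_on N UNIV"
    and norm_mult: "N (pr x y) = N x * N y"

locale octonion_algebra = composition_algebra +
  assumes dim_8: "dim UNIV = 8"

definition subalgebra ::
    "('k::field \<Rightarrow> 'c::ab_group_add \<Rightarrow> 'c) \<Rightarrow> ('c \<Rightarrow> 'c \<Rightarrow> 'c) \<Rightarrow> 'c \<Rightarrow> 'c set \<Rightarrow> bool" where
  "subalgebra scale pr e S \<longleftrightarrow>
     Modules.module.subspace scale S \<and> e \<in> S \<and> (\<forall>x\<in>S. \<forall>y\<in>S. pr x y \<in> S)"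

definition quaternion_subalgebra ::
    "('k::field \<Rightarrow> 'c::ab_group_add \<Rightarrow> 'c) \<Rightarrow> ('c \<Rightarrow> 'c \<Rightarrow> 'c) \<Rightarrow> 'c \<Rightarrow> ('c \<Rightarrow> 'k) \<Rightarrow> 'c set \<Rightarrow> bool"
  where
  "quaternion_subalgebra scale pr e N Q \<longleftrightarrow>
     subalgebra scale pr e Q \<and> vector_space.dim scale Q = 4 \<and> nondegenerate_on N Q"

definition quadratic_etale_subalgebra ::
    "('k::field \<Rightarrow> 'c::ab_group_add \<Rightarrow> 'c) \<Rightarrow> ('c \<Rightarrow> 'c \<Rightarrow> 'c) \<Rightarrow> 'c \<Rightarrow> ('c \<Rightarrow> 'k) \<Rightarrow> 'c set \<Rightarrow> bool"
  where
  "quadratic_etale_subalgebra scale pr e N L \<longleftrightarrow>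
     subalgebra scale pr e L \<and> vector_space.dim scale L = 2 \<and> nondegenerate_on N L"

definition subalgebra_ring ::
    "('c::ab_group_add \<Rightarrow> 'c \<Rightarrow> 'c) \<Rightarrow> 'c \<Rightarrow> 'c set \<Rightarrow> 'c ring" where
  "subalgebra_ring pr e L = \<lparr>carrier = L, mult = pr, one = e, zero = 0, add = (+)\<rparr>"

text \<open>\<open>L\<close> is isomorphic, as a \<open>k\<close>-algebra, to \<open>k \<times> k\<close> with componentwise operations.\<close>

definition split_quadratic ::
    "('k::field \<Rightarrow> 'c::ab_group_add \<Rightarrow> 'c) \<Rightarrow> ('c \<Rightarrow> 'c \<Rightarrow> 'c) \<Rightarrow> 'c \<Rightarrow> 'c set \<Rightarrow> bool" where
  "split_quadratic scale pr e L \<longleftrightarrow>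
     (\<exists>\<phi> :: 'c \<Rightarrow> 'k \<times> 'k. bij_betw \<phi> L UNIV \<and> \<phi> e = (1, 1) \<and>
       (\<forall>x\<in>L. \<forall>y\<in>L. \<phi> (x + y) = (fst (\<phi> x) + fst (\<phi> y), snd (\<phi> x) + snd (\<phi> y))) \<and>
       (\<forall>x\<in>L. \<forall>y\<in>L. \<phi> (pr x y) = (fst (\<phi> x) * fst (\<phi> y), snd (\<phi> x) * snd (\<phi> y))) \<and>
       (\<forall>a. \<forall>x\<in>L. \<phi> (scale a x) = (a * fst (\<phi> x), a * snd (\<phi> x))))"

text \<open>
  The standard involution of a composition algebra.  On a quadratic etale subalgebra that is a
  field it restricts to the nontrivial automorphism over \<open>k\<close>.
\<close>

definition conjugation ::
    "('k::field \<Rightarrow> 'c::ab_group_add \<Rightarrow> 'c) \<Rightarrow> 'c \<Rightarrow> ('c \<Rightarrow> 'k) \<Rightarrow> 'c \<Rightarrow> 'c" where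
  "conjugation scale e N x = scale (polar N x e) e - x"


section \<open>Automorphisms\<close>

definition algebra_automorphism ::
    "('k::field \<Rightarrow> 'c::ab_group_add \<Rightarrow> 'c) \<Rightarrow> ('c \<Rightarrow> 'c \<Rightarrow> 'c) \<Rightarrow> 'c \<Rightarrow> ('c \<Rightarrow> 'c) \<Rightarrow> bool" where
  "algebra_automorphism scale pr e f \<longleftrightarrow>
     bij f \<and> Vector_Spaces.linear scale scale f \<and> f e = e \<and> (\<forall>x y. f (pr x y) = pr (f x) (f y))"

text \<open>The group of \<open>k\<close>-rational points of the automorphism group.\<close>

definition aut_group ::
    "('k::field \<Rightarrow> 'c::ab_group_add \<Rightarrow> 'c) \<Rightarrow> ('c \<Rightarrow> 'c \<Rightarrow> 'c) \<Rightarrow> 'c \<Rightarrow> ('c \<Rightarrow> 'c) monoid" where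
  "aut_group scale pr e = BijGroup UNIV \<lparr>carrier := {f. algebra_automorphism scale pr e f}\<rparr>"

definition aut_fixing ::
    "('k::field \<Rightarrow> 'c::ab_group_add \<Rightarrow> 'c) \<Rightarrow> ('c \<Rightarrow> 'c \<Rightarrow> 'c) \<Rightarrow> 'c \<Rightarrow> 'c set \<Rightarrow> ('c \<Rightarrow> 'c) set" where
  "aut_fixing scale pr e L = {f \<in> carrier (aut_group scale pr e). \<forall>x\<in>L. f x = x}"

text \<open>
  A rational element of a linear algebraic group is semisimple iff it is diagonalizable over an
  algebraic closure of \<open>k\<close> in a faithful representation, here the one on the algebra itself.
  (Over an imperfect field this is stronger than complete reducibility over \<open>k\<close>.)
  Diagonalizability does not depend on the basis \<open>bs\<close>.
\<close>

definition matrix_of ::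
    "('k::field \<Rightarrow> 'c::ab_group_add \<Rightarrow> 'c) \<Rightarrow> 'c list \<Rightarrow> ('c \<Rightarrow> 'c) \<Rightarrow> 'k mat" where
  "matrix_of scale bs f =
     mat (length bs) (length bs)
       (\<lambda>(i, j). Modules.module.representation scale (set bs) (f (bs ! j)) (bs ! i))"

definition semisimple_endomorphism ::
    "('k::field \<Rightarrow> 'c::ab_group_add \<Rightarrow> 'c) \<Rightarrow> ('c \<Rightarrow> 'c) \<Rightarrow> bool" where
  "semisimple_endomorphism scale f \<longleftrightarrow>
     (\<exists>bs D. distinct bs \<and> \<not> Modules.module.dependent scale (set bs) \<and>
        Modules.module.span scale (set bs) = UNIV \<and>
        diagonal_mat D \<and> similar_mat (map_mat to_ac (matrix_of scale bs f)) D)"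


section \<open>Special unitary and special linear groups\<close>

text \<open>\<open>h\<close> is linear in the first and \<open>\<sigma>\<close>-semilinear in the second argument.\<close>

locale hermitian_space = vectorspace K V for K :: "('l, 'r) ring_scheme" and V :: "('l, 'v, 's) module_scheme" +
  fixes \<sigma> :: "'l \<Rightarrow> 'l" and h :: "'v \<Rightarrow> 'v \<Rightarrow> 'l"
  assumes involution_iso: "\<sigma> \<in> ring_iso K K"
    and involution: "a \<in> carrier K \<Longrightarrow> \<sigma> (\<sigma> a) = a"
    and form_closed: "x \<in> carrier V \<Longrightarrow> y \<in> carrier V \<Longrightarrow> h x y \<in> carrier K"
    and form_add: "x \<in> carrier V \<Longrightarrow> y \<in> carrier V \<Longrightarrow> z \<in> carrier V \<Longrightarrow>
          h (x \<oplus>\<^bsub>V\<^esub> y) z = h x z \<oplus>\<^bsub>K\<^esub> h y z"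
    and form_smult: "a \<in> carrier K \<Longrightarrow> x \<in> carrier V \<Longrightarrow> y \<in> carrier V \<Longrightarrow>
          h (a \<odot>\<^bsub>V\<^esub> x) y = a \<otimes>\<^bsub>K\<^esub> h x y"
    and form_hermitian: "x \<in> carrier V \<Longrightarrow> y \<in> carrier V \<Longrightarrow> h y x = \<sigma> (h x y)"
    and form_nondegenerate: "x \<in> carrier V \<Longrightarrow> (\<And>y. y \<in> carrier V \<Longrightarrow> h x y = \<zero>\<^bsub>K\<^esub>) \<Longrightarrow> x = \<zero>\<^bsub>V\<^esub>"

locale rank_hermitian_space = hermitian_space +
  fixes n :: nat
  assumes fin_dim: "fin_dim"
    and rank: "dim = n"

text \<open>
  The linear endomorphism \<open>f\<close> of \<open>V\<close> has determinant \<open>d\<close>: the Leibniz sum of its matrix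
  \<open>a\<close> in some (equivalently, any) ordered basis \<open>b\<close> is \<open>d\<close>.
\<close>

definition has_determinant ::
    "('l, 'r) ring_scheme \<Rightarrow> ('l, 'v, 's) module_scheme \<Rightarrow> ('v \<Rightarrow> 'v) \<Rightarrow> 'l \<Rightarrow> bool" where
  "has_determinant K V f d \<longleftrightarrow>
     (\<exists>(n::nat) b a. inj_on b {0..<n} \<and> vectorspace.basis K V (b ` {0..<n}) \<and>
        (\<forall>i<n. \<forall>j<n. a i j \<in> carrier K) \<and>
        (\<forall>j<n. f (b j) = (\<Oplus>\<^bsub>V\<^esub>i\<in>{0..<n}. a i j \<odot>\<^bsub>V\<^esub> b i)) \<and>
        d = (\<Oplus>\<^bsub>K\<^esub>p\<in>{p. p permutes {0..<n}}.
               if evenperm p then (\<Otimes>\<^bsub>K\<^esub>i\<in>{0..<n}. a i (p i))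
               else \<ominus>\<^bsub>K\<^esub> (\<Otimes>\<^bsub>K\<^esub>i\<in>{0..<n}. a i (p i))))"

definition SU ::
    "('l, 'r) ring_scheme \<Rightarrow> ('l, 'v, 's) module_scheme \<Rightarrow> ('v \<Rightarrow> 'v \<Rightarrow> 'l) \<Rightarrow> ('v \<Rightarrow> 'v) monoid" where
  "SU K V h = BijGroup (carrier V) \<lparr>carrier :=
     {f \<in> Bij (carrier V). f \<in> module_hom K V V \<and>
        (\<forall>x\<in>carrier V. \<forall>y\<in>carrier V. h (f x) (f y) = h x y) \<and>
        has_determinant K V f \<one>\<^bsub>K\<^esub>}\<rparr>"

definition SL :: "'k itself \<Rightarrow> nat \<Rightarrow> 'k::field mat monoid" where
  "SL _ n = \<lparr>carrier = {A \<in> carrier_mat n n. det A = 1}, mult = (*), one = 1\<^sub>m n\<rparr>"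

end

theory Submission
  imports Defs
begin

text \<open>
  Write \<open>t\<close> for \<open>t0\<close> and \<open>K = t - t\<inverse>\<close>, which is skew for the polar form.  The complement of \<open>e\<close> has
  dimension 7, so \<open>K\<close> is singular there and \<open>t\<^sup>2\<close> fixes a nonzero \<open>x\<close> orthogonal to \<open>e\<close>.  Suppose
  that \<open>t\<close> fixes no such vector.  Then \<open>t x = - x\<close>, and since semisimplicity makes eigenspaces for
  \<open>\<plusminus>1\<close> nondegenerate, \<open>t y = - y\<close> for some \<open>y\<close> with \<open>N y \<noteq> 0\<close>.  Put \<open>L = k[y]\<close> and let \<open>V\<close> be its
  orthogonal complement, a free \<open>L\<close>-module of rank 3.  As \<open>K\<close> anticommutes with \<open>y\<close>, it defines an
  alternating \<open>L\<close>-bilinear form on \<open>V\<close>, which is again singular.  This yields \<open>u \<in> V\<close> with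
  \<open>t u = - u\<close>, and \<open>y u\<close> is fixed, a contradiction.  So \<open>t\<close> has fixed vectors orthogonal to \<open>e\<close>, and
  by nondegeneracy a fixed quadratic etale subalgebra: the second alternative always holds.

  For \<open>L\<close> fixed pointwise, the product on \<open>V\<close> is encoded by a hermitian form \<open>h\<close> over \<open>L\<close> and by the
  form \<open>tau u v w = B u (v w)\<close>, which is alternating and satisfies
  \<open>tau (l u) v w = tau u (l v) w = tau u v (l w)\<close> for \<open>l\<close> in \<open>L\<close>.  Hence an
  \<open>L\<close>-linear endomorphism acts on \<open>tau\<close> through its determinant, and the isometries of determinant 1
  are exactly the restrictions of automorphisms.  If \<open>L = k p \<oplus> k q\<close> with orthogonal
  idempotents, then \<open>q V\<close> is dual to \<open>p V\<close>, and an isometry is determined by an arbitrary linear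
  automorphism of \<open>p V\<close>.
\<close>

section \<open>Identities in composition algebras\<close>

locale composition_algebra_not_char_2 = composition_algebra scale pr e N
  for scale :: "'k::field \<Rightarrow> 'c::ab_group_add \<Rightarrow> 'c" (infixr "*s" 75)
    and pr :: "'c \<Rightarrow> 'c \<Rightarrow> 'c" (infixl "\<star>" 70) and e :: 'c and N :: "'c \<Rightarrow> 'k" +
  assumes char_not_2: "CHAR('k) \<noteq> 2" and e_neq_0: "e \<noteq> 0"
begin

abbreviation B :: "'c \<Rightarrow> 'c \<Rightarrow> 'k" where "B \<equiv> polar N"

abbreviation conj :: "'c \<Rightarrow> 'c" where "conj \<equiv> conjugation scale e N"

lemma two_neq_0 [simp]: "(2::'k) \<noteq> 0"
proof
  assume "(2::'k) = 0"
  then have "CHAR('k) dvd 2"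
    by (metis of_nat_eq_0_iff_char_dvd of_nat_numeral)
  then have "CHAR('k) = 1 \<or> CHAR('k) = 2"
    using prime_nat_iff two_is_prime_nat by blast
  then show False
    using char_not_2 CHAR_not_1 by auto
qed

lemma pr_add_left: "(x + y) \<star> z = x \<star> z + y \<star> z"
  and pr_scale_left: "(a *s x) \<star> z = a *s (x \<star> z)"
  using linear_left[of z]
  by (simp_all add: Vector_Spaces.linear_def Modules.module_hom_def module_hom_axioms_def)

lemma pr_add_right: "z \<star> (x + y) = z \<star> x + z \<star> y"
  and pr_scale_right: "z \<star> (a *s x) = a *s (z \<star> x)"
  using linear_right[of z]
  by (simp_all add: Vector_Spaces.linear_def Modules.module_hom_def module_hom_axioms_def)

lemma pr_zero_left [simp]: "0 \<star> z = 0"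
  using pr_add_left[of 0 0 z] by simp

lemma pr_zero_right [simp]: "z \<star> 0 = 0"
  using pr_add_right[of z 0 0] by simp

lemma pr_minus_left: "(- x) \<star> z = - (x \<star> z)"
  using pr_add_left[of x "-x" z] by (simp add: eq_neg_iff_add_eq_0 add.commute)

lemma pr_minus_right: "z \<star> (- x) = - (z \<star> x)"
  using pr_add_right[of z x "-x"] by (simp add: eq_neg_iff_add_eq_0 add.commute)

lemma pr_diff_left: "(x - y) \<star> z = x \<star> z - y \<star> z"
  using pr_add_left[of x "-y" z] by (simp add: pr_minus_left)

lemma pr_diff_right: "z \<star> (x - y) = z \<star> x - z \<star> y"
  using pr_add_right[of z x "-y"] by (simp add: pr_minus_right)

lemmas pr_linear = pr_add_left pr_add_right pr_scale_left pr_scale_right pr_minus_left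
  pr_minus_right pr_diff_left pr_diff_right

lemma B_commute: "B x y = B y x"
  by (simp add: polar_def add.commute algebra_simps)

lemma B_add_left: "B (x + y) z = B x z + B y z"
  and B_scale_left: "B (a *s x) z = a * B x z"
  using norm_quadratic 
  by (simp_all add: quadratic_form_def Vector_Spaces.linear_def Modules.module_hom_def module_hom_axioms_def)

lemma B_add_right: "B z (x + y) = B z x + B z y"
  and B_scale_right: "B z (a *s x) = a * B z x"
  by (simp_all add: B_commute[of z] B_add_left B_scale_left)

lemma B_zero_left [simp]: "B 0 z = 0"
  using B_scale_left[of 0 0 z] by simp

lemma B_zero_right [simp]: "B z 0 = 0"
  using B_scale_right[of z 0 0] by simp

lemma B_minus_left: "B (- x) z = - B x z"
  using B_add_left[of x "-x" z] by (simp add: eq_neg_iff_add_eq_0 add.commute)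

lemma B_minus_right: "B z (- x) = - B z x"
  using B_add_right[of z x "-x"] by (simp add: eq_neg_iff_add_eq_0 add.commute)

lemma B_diff_left: "B (x - y) z = B x z - B y z"
  using B_add_left[of x "-y" z] by (simp add: B_minus_left)

lemma B_diff_right: "B z (x - y) = B z x - B z y"
  using B_add_right[of z x "-y"] by (simp add: B_minus_right)

lemmas B_linear = B_add_left B_add_right B_scale_left B_scale_right B_minus_left
  B_minus_right B_diff_left B_diff_right

lemma B_sum_left: "B (\<Sum>i\<in>I. f i) z = (\<Sum>i\<in>I. B (f i) z)"
  by (induction I rule: infinite_finite_induct) (auto simp: B_add_left)

lemma B_sum_right: "B z (\<Sum>i\<in>I. f i) = (\<Sum>i\<in>I. B z (f i))"
  by (simp add: B_commute[of z] B_sum_left)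

lemma N_scale: "N (a *s x) = a\<^sup>2 * N x"
  using norm_quadratic by (simp add: quadratic_form_def)

lemma N_zero [simp]: "N 0 = 0"
  using N_scale[of 0 0] by simp

lemma B_self: "B x x = 2 * N x"
  using N_scale[of 2 x] scale_left_distrib[of 1 1 x] by (simp add: polar_def)

lemma N_B: "N x = B x x / 2"
  by (simp add: B_self)

lemma N_add: "N (x + y) = N x + N y + B x y"
  by (simp add: polar_def)

text \<open>Nondegeneracy as an extensionality principle: identities between vectors are reduced to
  scalar identities by pairing with an arbitrary \<open>z\<close>.\<close>

lemma eq_of_B: assumes "\<And>z. B x z = B y z" shows "x = y"
proof -
  have "\<forall>z\<in>UNIV. B (x - y) z = 0" using assms by (simp add: B_diff_left)
  then have "x - y = 0" using norm_nondegenerate unfolding nondegenerate_on_def by blast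
  then show ?thesis by simp
qed

text \<open>The composition law gives \<open>N z = N e * N z\<close>, so
  \<open>N e \<noteq> 1\<close> would make \<open>N\<close>, and with it the polar form, vanish
  identically.\<close>

lemma N_e [simp]: "N e = 1"
proof (rule ccontr)
  assume "N e \<noteq> 1"
  then have *: "N z = 0" for z
    using norm_mult[of e z] by (simp add: unit_left)
  have "e = 0" by (rule eq_of_B) (simp add: polar_def *)
  with e_neq_0 show False by simp
qed

lemma B_mult_left: "B (z \<star> x) (z \<star> y) = N z * B x y"
  using norm_mult[of z "x + y"] by (simp add: pr_linear polar_def norm_mult algebra_simps)

lemma B_mult_right: "B (x \<star> z) (y \<star> z) = N z * B x y"
  using norm_mult[of "x + y" z] by (simp add: pr_linear polar_def norm_mult algebra_simps)

text \<open>The composition law polarized in both factors. Specializing one argument to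
  \<open>e\<close> yields the adjoints of the multiplications.\<close>

lemma B_exchange: "B (x \<star> z) (y \<star> w) + B (x \<star> w) (y \<star> z) = B x y * B z w"
  using B_mult_right[of x "z + w" y] B_mult_right[of x z y] B_mult_right[of x w y]
  by (simp add: pr_linear B_linear N_add B_commute[of w z] algebra_simps)

lemma conj_eq: "conj x = B x e *s e - x"
  by (simp add: conjugation_def)

lemma conj_linear: "conj (x + y) = conj x + conj y" "conj (a *s x) = a *s conj x"
  "conj (- x) = - conj x" "conj (x - y) = conj x - conj y"
  by (simp_all add: conj_eq B_linear algebra_simps)

lemma B_adjoint_left: "B (x \<star> z) w = B z (conj x \<star> w)"
  using B_exchange[of x z e w]
  by (simp add: conj_eq pr_linear B_linear unit_left algebra_simps B_commute[of "x \<star> w" z])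

lemma B_adjoint_right: "B (z \<star> x) w = B z (w \<star> conj x)"
  using B_exchange[of z x w e]
  by (simp add: conj_eq pr_linear B_linear unit_right algebra_simps)

lemma B_e_e [simp]: "B e e = 2"
  by (simp add: B_self)

lemma conj_e [simp]: "conj e = e"
  using scale_left_distrib[of 1 1 e] by (simp add: conj_eq)

lemma conj_conj [simp]: "conj (conj x) = x"
  by (simp add: conj_eq B_linear)

lemma B_conj_conj [simp]: "B (conj x) (conj y) = B x y"
  by (simp add: conj_eq B_linear B_commute[of e y])

text \<open>Multiplications are moved across \<open>B\<close> as their adjoints until the two
  factors stand in the opposite order.\<close>

lemma conj_mult: "conj (x \<star> y) = conj y \<star> conj x"
proof (rule eq_of_B)
  fix z
  have "B (conj (x \<star> y)) z = B (x \<star> y) (conj z)"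
    using B_conj_conj[of "x \<star> y" "conj z"] by simp
  also have "\<dots> = B y (conj x \<star> conj z)" by (rule B_adjoint_left)
  also have "\<dots> = B (y \<star> z) (conj x)"
    using B_adjoint_right[of "conj x" "conj z" y] by (simp add: B_commute)
  also have "\<dots> = B (conj y \<star> conj x) z"
    using B_adjoint_left[of y z "conj x"] by (simp add: B_commute)
  finally show "B (conj (x \<star> y)) z = B (conj y \<star> conj x) z" .
qed

text \<open>Left multiplications by \<open>x\<close> and \<open>conj x\<close> are adjoint, so
  pairing with \<open>z\<close> gives \<open>B (x \<star> y) (x \<star> z)\<close>, which is
  \<open>N x * B y z\<close>.\<close>

lemma conj_mult_left_cancel: "conj x \<star> (x \<star> y) = N x *s y"
proof (rule eq_of_B)
  fix z
  show "B (conj x \<star> (x \<star> y)) z = B (N x *s y) z"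
    using B_adjoint_left[of "conj x" "x \<star> y" z] by (simp add: B_mult_left B_linear)
qed

lemma conj_mult_left_linear: "conj x \<star> (z \<star> y) + conj z \<star> (x \<star> y) = B x z *s y"
proof -
  have "conj (x + z) \<star> ((x + z) \<star> y) = N (x + z) *s y" by (rule conj_mult_left_cancel)
  then show ?thesis
    by (simp add: conj_linear pr_linear N_add conj_mult_left_cancel algebra_simps)
qed

lemma mult_self: "x \<star> x = B x e *s x - N x *s e"
  using conj_mult_left_cancel[of x e] by (simp add: conj_eq pr_linear unit_left unit_right algebra_simps)

text \<open>Replacing \<open>conj x\<close> by \<open>B x e *s e - x\<close> in
  \<open>conj_mult_left_cancel\<close> turns that law into this weak form of associativity.\<close>

lemma left_alternative: "x \<star> (x \<star> y) = (x \<star> x) \<star> y"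
  using conj_mult_left_cancel[of x y]
  by (simp add: mult_self conj_eq[of x] pr_linear unit_left algebra_simps)

end

section \<open>Orthogonal families and the complement of a quadratic subalgebra\<close>

locale octonion_algebra_not_char_2 =
  composition_algebra_not_char_2 scale pr e N + octonion_algebra scale pr e N
  for scale :: "'k::field \<Rightarrow> 'c::ab_group_add \<Rightarrow> 'c" (infixr "*s" 75)
    and pr :: "'c \<Rightarrow> 'c \<Rightarrow> 'c" (infixl "\<star>" 70) and e :: 'c and N :: "'c \<Rightarrow> 'k"
begin

definition orthogonal_family :: "'c set \<Rightarrow> bool" where
  "orthogonal_family S \<longleftrightarrow>
     finite S \<and> (\<forall>x\<in>S. N x \<noteq> 0) \<and> (\<forall>x\<in>S. \<forall>y\<in>S. x \<noteq> y \<longrightarrow> B x y = 0)"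

lemma orthogonal_family_insert:
  assumes "orthogonal_family S" "N x \<noteq> 0" "\<And>s. s \<in> S \<Longrightarrow> B x s = 0"
  shows "orthogonal_family (insert x S)" "x \<notin> S"
proof -
  show "orthogonal_family (insert x S)"
    using assms by (auto simp: orthogonal_family_def) (metis B_commute)
  show "x \<notin> S"
    using assms(2) assms(3)[of x] by (auto simp: B_self)
qed

lemma orthogonal_family_empty: "orthogonal_family {}"
  by (simp add: orthogonal_family_def)

lemma orthogonal_family_step:
  assumes "orthogonal_family S \<and> card S = n" "N x \<noteq> 0" "\<forall>s\<in>S. B x s = 0"
  shows "orthogonal_family (insert x S) \<and> card (insert x S) = Suc n"
  using assms orthogonal_family_insert[of S x] by (simp add: orthogonal_family_def[of S])

lemma B_orthogonal_sum:
  assumes "orthogonal_family S" "s \<in> S"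
  shows "B (\<Sum>x\<in>S. u x *s x) s = 2 * N s * u s"
proof -
  have "B (\<Sum>x\<in>S. u x *s x) s = (\<Sum>x\<in>S. if x = s then 2 * N s * u s else 0)"
    unfolding B_sum_left
    using assms by (intro sum.cong) (auto simp: orthogonal_family_def B_linear B_self)
  then show ?thesis
    using assms by (simp add: orthogonal_family_def)
qed

lemma orthogonal_family_independent:
  assumes "orthogonal_family S"
  shows "independent S"
proof (rule independent_if_scalars_zero)
  show "finite S" using assms by (simp add: orthogonal_family_def)
next
  fix u x assume "(\<Sum>x\<in>S. u x *s x) = 0" "x \<in> S"
  then have "2 * N x * u x = 0"
    using B_orthogonal_sum[OF assms, of x u] by simp
  then show "u x = 0" using assms \<open>x \<in> S\<close> by (auto simp: orthogonal_family_def)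
qed

definition orthogonal_projection :: "'c set \<Rightarrow> 'c \<Rightarrow> 'c" where
  "orthogonal_projection S x = (\<Sum>s\<in>S. (B x s / (2 * N s)) *s s)"

lemma B_orthogonal_projection:
  assumes "orthogonal_family S" "s \<in> S"
  shows "B (orthogonal_projection S x) s = B x s"
  using assms B_orthogonal_sum[OF assms, of "\<lambda>s. B x s / (2 * N s)"]
  by (auto simp: orthogonal_projection_def orthogonal_family_def)

lemma orthogonal_projection_in_span: "orthogonal_projection S x \<in> span S"
  unfolding orthogonal_projection_def by (intro span_sum span_scale span_base)

text \<open>If every vector orthogonal to \<open>S\<close> were isotropic, \<open>B\<close> would
  vanish on the complement of \<open>S\<close>. The component \<open>?P x\<close> of a vector
  outside \<open>span S\<close> would then be orthogonal to everything, against
  nondegeneracy.\<close>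

lemma ex_anisotropic_orthogonal:
  assumes S: "orthogonal_family S" and "span S \<noteq> UNIV"
  shows "\<exists>x. N x \<noteq> 0 \<and> (\<forall>s\<in>S. B x s = 0)"
proof (rule ccontr)
  assume *: "\<not> ?thesis"
  let ?P = "\<lambda>x. x - orthogonal_projection S x"
  obtain x where x: "x \<notin> span S" using assms(2) by blast
  have P: "B (?P z) s = 0" if "s \<in> S" for z s
    using B_orthogonal_projection[OF S that, of z] by (simp add: B_linear)
  have "B (?P x) z = B 0 z" for z
  proof -
    have "B (?P x) (orthogonal_projection S z) = 0"
      unfolding orthogonal_projection_def[of S z] B_sum_right B_scale_right
      by (simp add: P del: B_diff_left)
    then have "B (?P x) z = B (?P x) (?P z)"
      by (simp add: B_diff_right)
    also have "\<dots> = 0"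
    proof -
      have "N (?P x) = 0" "N (?P z) = 0" using * P by blast+
      moreover have "\<forall>s\<in>S. B (?P x + ?P z) s = 0"
        by (metis B_add_left P add_0)
      then have "N (?P x + ?P z) = 0"
        using * by blast
      ultimately show ?thesis by (simp add: polar_def)
    qed
    finally show ?thesis by simp
  qed
  then have "?P x = 0" by (rule eq_of_B)
  then have "x = orthogonal_projection S x" by simp
  then show False using x orthogonal_projection_in_span by metis
qed

lemma ex_anisotropic_orthogonal_card:
  assumes "orthogonal_family S" "card S < 8"
  shows "\<exists>x. N x \<noteq> 0 \<and> (\<forall>s\<in>S. B x s = 0)"
proof (rule ex_anisotropic_orthogonal[OF assms(1)])
  show "span S \<noteq> UNIV"
    using assms(2) dim_8 dim_span_eq_card_independent[OF orthogonal_family_independent[OF assms(1)]]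
    by (metis less_irrefl)
qed

lemma finite_spanning_set: "\<exists>T. finite T \<and> card T = 8 \<and> independent T \<and> span T = UNIV"
proof -
  obtain T where "independent T" "UNIV \<subseteq> span T" "card T = dim UNIV"
    using basis_exists by blast
  \<comment> \<open>An infinite basis would have \<open>card\<close> 0 instead of 8, so the basis is
    finite.\<close>
  then show ?thesis using dim_8 by (metis card.infinite top.extremum_uniqueI zero_neq_numeral)
qed

text \<open>Eight members already span: otherwise a ninth anisotropic vector orthogonal to them
  would give nine independent vectors.\<close>

lemma orthogonal_expansion:
  assumes S: "orthogonal_family S" and "card S = 8"
  shows "x = (\<Sum>s\<in>S. (B x s / (2 * N s)) *s s)"
proof -
  have "span S = UNIV"
  proof (rule ccontr)
    assume "span S \<noteq> UNIV"
    then obtain z where "N z \<noteq> 0" "\<forall>s\<in>S. B z s = 0"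
      using ex_anisotropic_orthogonal S by blast
    then have z: "orthogonal_family (insert z S)" "z \<notin> S"
      using orthogonal_family_insert[OF S, of z] by auto
    obtain T where T: "finite T" "card T = 8" "span T = UNIV"
      using finite_spanning_set by blast
    have "card (insert z S) \<le> card T"
      using independent_span_bound[OF T(1) orthogonal_family_independent[OF z(1)]] T by auto
    then show False
      using T z S assms(2) by (simp add: orthogonal_family_def)
  qed
  have "B (x - orthogonal_projection S x) z = B 0 z" for z
  proof -
    have "z \<in> span S" using \<open>span S = UNIV\<close> by simp
    then show ?thesis
    proof (induction rule: span_induct_alt)
      case (step c s w)
      then show ?case using B_orthogonal_projection[OF S step.hyps(1), of x] by (simp add: B_linear)
    qed simp
  qed
  then have "x - orthogonal_projection S x = 0" by (rule eq_of_B)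
  then show ?thesis by (simp add: orthogonal_projection_def)
qed

end

section \<open>The splitting of the algebra into a quadratic subalgebra \<open>L\<close> and its
  complement \<open>V\<close>\<close>

locale octonion_quadratic = octonion_algebra_not_char_2 scale pr e N
  for scale :: "'k::field \<Rightarrow> 'c::ab_group_add \<Rightarrow> 'c" (infixr "*s" 75)
    and pr :: "'c \<Rightarrow> 'c \<Rightarrow> 'c" (infixl "\<star>" 70) and e :: 'c and N :: "'c \<Rightarrow> 'k" +
  fixes y :: 'c
  assumes y_e: "B y e = 0" and N_y: "N y \<noteq> 0"
begin

text \<open>Every quadratic etale subalgebra has this form for a suitable \<open>y\<close>; see
  \<open>quadratic_etale_obtain\<close>.\<close>

definition L :: "'c set" where "L = {a *s e + b *s y | a b. True}"

definition V :: "'c set" where "V = {v. B v e = 0 \<and> B v y = 0}"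

lemma e_y [simp]: "B e y = 0"
  using y_e by (simp add: B_commute)

declare y_e [simp] N_y [simp]

lemma conj_y [simp]: "conj y = - y"
  by (simp add: conj_eq)

lemma y_y [simp]: "y \<star> y = - (N y *s e)"
  by (simp add: mult_self)

lemma y_y_mult [simp]: "y \<star> (y \<star> x) = - (N y *s x)"
  by (simp add: left_alternative pr_linear unit_left)

lemma LE:
  assumes "l \<in> L" obtains a b where "l = a *s e + b *s y"
  using assms by (auto simp: L_def)

lemma L_I [simp]: "a *s e + b *s y \<in> L"
  by (auto simp: L_def)

lemma e_in_L [simp]: "e \<in> L"
  using L_I[of 1 0] by simp

lemma y_in_L [simp]: "y \<in> L"
  using L_I[of 0 1] by simp

lemma L_subspace: "subspace L"
  unfolding subspace_def
proof (intro conjI ballI allI)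
  show "0 \<in> L" using L_I[of 0 0] by simp
next
  fix l m assume "l \<in> L" "m \<in> L"
  then obtain a b c d where "l = a *s e + b *s y" "m = c *s e + d *s y" by (metis LE)
  then have "l + m = (a + c) *s e + (b + d) *s y"
    by (simp add: algebra_simps)
  then show "l + m \<in> L" by simp
next
  fix c l assume "l \<in> L"
  then obtain a b where "l = a *s e + b *s y" by (metis LE)
  then have "c *s l = (c * a) *s e + (c * b) *s y"
    by (simp add: algebra_simps)
  then show "c *s l \<in> L" by simp
qed

lemma L_closed [simp]:
  "0 \<in> L" "l \<in> L \<Longrightarrow> m \<in> L \<Longrightarrow> l + m \<in> L" "l \<in> L \<Longrightarrow> c *s l \<in> L"
  "l \<in> L \<Longrightarrow> - l \<in> L" "l \<in> L \<Longrightarrow> m \<in> L \<Longrightarrow> l - m \<in> L"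
  using L_subspace by (auto simp: subspace_0 subspace_add subspace_scale subspace_neg subspace_diff)

lemma L_mult_eq:
  "(a *s e + b *s y) \<star> (c *s e + d *s y) = (a * c - N y * b * d) *s e + (a * d + b * c) *s y"
  by (simp add: pr_linear unit_left unit_right algebra_simps)

lemma L_mult [simp]: "l \<in> L \<Longrightarrow> m \<in> L \<Longrightarrow> l \<star> m \<in> L"
  by (metis LE L_mult_eq L_I)

lemma L_commute: "l \<in> L \<Longrightarrow> m \<in> L \<Longrightarrow> l \<star> m = m \<star> l"
  by (elim LE) (simp add: L_mult_eq algebra_simps)

text \<open>The algebra is not associative, but \<open>left_alternative\<close> makes left
  multiplication by \<open>L\<close> an associative action. This is the source of the
  \<open>L\<close>-module structure on \<open>V\<close>.\<close>

lemma L_act_assoc: "l \<in> L \<Longrightarrow> m \<in> L \<Longrightarrow> l \<star> (m \<star> x) = l \<star> m \<star> x"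
  by (elim LE) (simp add: pr_linear unit_left unit_right algebra_simps)

lemma conj_L_eq: "conj (a *s e + b *s y) = a *s e - b *s y"
  by (simp add: conj_linear)

lemma conj_L [simp]: "l \<in> L \<Longrightarrow> conj l \<in> L"
  by (elim LE) (simp add: conj_linear)

lemma V_closed [simp]:
  "0 \<in> V" "u \<in> V \<Longrightarrow> v \<in> V \<Longrightarrow> u + v \<in> V" "v \<in> V \<Longrightarrow> c *s v \<in> V"
  "v \<in> V \<Longrightarrow> - v \<in> V" "u \<in> V \<Longrightarrow> v \<in> V \<Longrightarrow> u - v \<in> V"
  by (auto simp: V_def B_linear)

lemma B_V_L [simp]: "v \<in> V \<Longrightarrow> l \<in> L \<Longrightarrow> B v l = 0" "v \<in> V \<Longrightarrow> l \<in> L \<Longrightarrow> B l v = 0"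
  by (auto simp: V_def L_def B_linear B_commute[of e v] B_commute[of y v])

lemma V_I: "B v e = 0 \<Longrightarrow> B v y = 0 \<Longrightarrow> v \<in> V"
  unfolding V_def by blast

lemma V_iff: "v \<in> V \<longleftrightarrow> (\<forall>l\<in>L. B v l = 0)"
  using B_V_L(1) V_I e_in_L y_in_L by blast

lemma conj_V: "v \<in> V \<Longrightarrow> conj v = - v"
  by (simp add: conj_eq)

lemma L_V [simp]: "l \<in> L \<Longrightarrow> v \<in> V \<Longrightarrow> l \<star> v \<in> V"
  by (subst V_iff, intro ballI, subst B_adjoint_left, rule B_V_L) simp_all

text \<open>\<open>conj\<close> reverses products and is \<open>- 1\<close> on \<open>V\<close>; it
  is applied to \<open>conj l \<star> v\<close>, which again lies in \<open>V\<close>.\<close>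

lemma V_L: "l \<in> L \<Longrightarrow> v \<in> V \<Longrightarrow> v \<star> l = conj l \<star> v"
  using conj_mult[of "conj l" v] by (simp add: conj_V pr_linear)

lemma V_V_self: "v \<in> V \<Longrightarrow> v \<star> v = - (N v *s e)"
  by (simp add: mult_self)

text \<open>Up to the trace from \<open>L\<close> to \<open>k\<close>, this is a determinant form on the rank 3 module \<open>V\<close>.\<close>

definition tau :: "'c \<Rightarrow> 'c \<Rightarrow> 'c \<Rightarrow> 'k" where "tau u v w = B u (v \<star> w)"

lemma tau_linear:
  "tau (u + u') v w = tau u v w + tau u' v w" "tau (a *s u) v w = a * tau u v w"
  "tau u (v + v') w = tau u v w + tau u v' w" "tau u (a *s v) w = a * tau u v w"
  "tau u v (w + w') = tau u v w + tau u v w'" "tau u v (a *s w) = a * tau u v w"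
  "tau (- u) v w = - tau u v w" "tau u (- v) w = - tau u v w" "tau u v (- w) = - tau u v w"
  "tau (u - u') v w = tau u v w - tau u' v w"
  by (simp_all add: tau_def pr_linear B_linear)

text \<open>In the first two cases multiplicativity pulls out \<open>N u\<close> and leaves
  \<open>B e v\<close>, which is 0 on \<open>V\<close>; in the last one \<open>u \<star> u\<close>
  is a multiple of \<open>e\<close>.\<close>

lemma tau_eq_0: assumes "u \<in> V" "v \<in> V" shows "tau u u v = 0" "tau u v u = 0" "tau v u u = 0"
proof -
  show "tau u u v = 0"
    using B_mult_left[of u e v] assms by (simp add: tau_def unit_right)
  show "tau u v u = 0"
    using B_mult_right[of e u v] assms by (simp add: tau_def unit_left)
  show "tau v u u = 0"
    using assms by (simp add: tau_def V_V_self B_linear)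
qed

lemma tau_swap:
  assumes "u \<in> V" "v \<in> V" "w \<in> V"
  shows "tau v u w = - tau u v w" "tau u w v = - tau u v w" "tau w v u = - tau u v w"
proof -
  show "tau v u w = - tau u v w"
    using tau_eq_0(1)[of "u + v" w] tau_eq_0(1)[of u w] tau_eq_0(1)[of v w] assms
    by (simp add: tau_linear eq_neg_iff_add_eq_0 add.commute)
  show "tau u w v = - tau u v w"
    using tau_eq_0(3)[of "w + v" u] tau_eq_0(3)[of w u] tau_eq_0(3)[of v u] assms
    by (simp add: tau_linear eq_neg_iff_add_eq_0 add.commute)
  show "tau w v u = - tau u v w"
    using tau_eq_0(2)[of "u + w" v] tau_eq_0(2)[of u v] tau_eq_0(2)[of w v] assms
    by (simp add: tau_linear eq_neg_iff_add_eq_0 add.commute)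
qed

text \<open>For orthogonal \<open>y\<close> and \<open>v\<close>, linearized cancellation gives
  \<open>v \<star> (y \<star> w) = - (y \<star> (v \<star> w))\<close>, and the adjoint of left
  multiplication by \<open>y\<close> is its negative.\<close>

lemma tau_y_last:
  assumes "v \<in> V"
  shows "tau u v (y \<star> w) = tau (y \<star> u) v w"
proof -
  have "B y v = 0" using assms by simp
  then have "- (y \<star> (v \<star> w)) = v \<star> (y \<star> w)"
    using conj_mult_left_linear[of y v w] assms by (simp add: conj_V pr_linear)
  from this[symmetric] show ?thesis
    by (simp add: tau_def B_adjoint_left[of y u] B_linear pr_linear)
qed

text \<open>Transpose the first two arguments, pass \<open>y\<close> to the last one by
  \<open>tau_y_last\<close>, transpose back and pass \<open>y\<close> to the front.\<close>

lemma tau_y_middle: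
  assumes "u \<in> V" "v \<in> V" "w \<in> V"
  shows "tau u (y \<star> v) w = tau (y \<star> u) v w"
proof -
  have "tau u (y \<star> v) w = - tau (y \<star> v) u w"
    using assms tau_swap(1)[of "y \<star> v" u w] by simp
  also have "\<dots> = - tau v u (y \<star> w)"
    using tau_y_last[of u v w] assms by simp
  also have "\<dots> = tau (y \<star> u) v w"
    using assms tau_swap(1)[of u v "y \<star> w"] tau_y_last[of v u w] by simp
  finally show ?thesis .
qed

lemma tau_balanced:
  assumes "u \<in> V" "v \<in> V" "w \<in> V" "l \<in> L"
  shows "tau u (l \<star> v) w = tau (l \<star> u) v w" "tau u v (l \<star> w) = tau (l \<star> u) v w"
  using assms
  by (auto elim!: LE simp: pr_linear unit_left tau_linear tau_y_last tau_y_middle)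

lemma L_eqI:
  assumes "l \<in> L" "m \<in> L" "\<And>n. n \<in> L \<Longrightarrow> B l n = B m n"
  shows "l = m"
proof -
  obtain a b where ab: "l - m = a *s e + b *s y"
    using assms by (metis LE L_closed(5))
  have "B (l - m) e = 0" "B (l - m) y = 0"
    using assms by (simp_all add: B_diff_left)
  then have "a = 0" "b = 0"
    by (simp_all add: ab B_linear B_self)
  then show ?thesis using ab by simp
qed

text \<open>The \<open>L\<close>-valued form whose pairing with \<open>l\<close> in \<open>L\<close>
  is \<open>B x (l \<star> w)\<close>; the denominators are \<open>B e e\<close> and
  \<open>B y y\<close>. Nondegeneracy of \<open>B\<close> on \<open>L\<close> makes it unique, and
  its basic properties are read off from this through \<open>h_eqI\<close>.\<close>

definition h :: "'c \<Rightarrow> 'c \<Rightarrow> 'c" where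
  "h x w = (B x w / 2) *s e + (B x (y \<star> w) / (2 * N y)) *s y"

lemma h_L [simp]: "h x w \<in> L"
  by (simp add: h_def)

lemma B_h: "l \<in> L \<Longrightarrow> B (h x w) l = B x (l \<star> w)"
  by (elim LE) (simp add: h_def B_linear pr_linear unit_left B_self algebra_simps)

lemma h_eqI: "l \<in> L \<Longrightarrow> (\<And>m. m \<in> L \<Longrightarrow> B l m = B x (m \<star> w)) \<Longrightarrow> h x w = l"
  by (intro L_eqI) (simp_all add: B_h)

lemma h_add: "h (x + x') w = h x w + h x' w"
  by (intro h_eqI) (simp_all add: B_h B_linear)

lemma h_L_mult: "l \<in> L \<Longrightarrow> h (l \<star> x) w = l \<star> h x w"
  by (intro h_eqI) (simp_all add: B_h B_adjoint_left L_act_assoc)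

lemma h_commute: "h w x = conj (h x w)"
proof (rule h_eqI)
  fix m assume m: "m \<in> L"
  have "B (conj (h x w)) m = B (h x w) (conj m)"
    using B_conj_conj[of "h x w" "conj m"] by simp
  also have "\<dots> = B x (conj m \<star> w)" using m by (simp add: B_h)
  also have "\<dots> = B w (m \<star> x)" using B_adjoint_left[of m x w] B_commute[of "m \<star> x" w] by simp
  finally show "B (conj (h x w)) m = B w (m \<star> x)" .
qed simp

lemma h_self: "h x x = N x *s e"
proof (rule h_eqI)
  fix m assume "m \<in> L"
  then show "B (N x *s e) m = B x (m \<star> x)"
    using B_mult_right[of e x m] by (simp add: B_linear unit_left)
qed simp

lemma h_eq_0_commute: "h x w = 0 \<Longrightarrow> h w x = 0"
  by (simp add: h_commute[of w x] conj_eq)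

lemma h_eq_0_iff: "h x w = 0 \<longleftrightarrow> B x w = 0 \<and> B x (y \<star> w) = 0"
proof
  assume "h x w = 0"
  then show "B x w = 0 \<and> B x (y \<star> w) = 0"
    using B_h[of e x w] B_h[of y x w] by (simp add: unit_left)
qed (simp add: h_def)

lemma B_L_mult_h: "l \<in> L \<Longrightarrow> m \<in> L \<Longrightarrow> B (l \<star> x) (m \<star> w) = B (l \<star> h x w) m"
  using B_h[of m "l \<star> x" w] by (simp add: h_L_mult)

lemma tau_L_repeat:
  assumes "u \<in> V" "v \<in> V" "l \<in> L"
  shows "tau (l \<star> u) u v = 0" "tau (l \<star> u) v u = 0" "tau (l \<star> v) u u = 0"
proof -
  show "tau (l \<star> v) u u = 0" using assms by (intro tau_eq_0) simp_all
  show "tau (l \<star> u) u v = 0"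
    using assms tau_balanced(2)[of u u v l] by (simp add: tau_eq_0)
  show "tau (l \<star> u) v u = 0"
    using assms tau_balanced(1)[of u v u l] by (simp add: tau_eq_0)
qed

text \<open>One rule for each nontrivial permutation of the arguments. The scalar always stays on
  the first argument, so that the rules bring terms to a common form in
  \<open>tau_det3\<close>.\<close>

lemma tau_L_swap:
  assumes "u \<in> V" "v \<in> V" "w \<in> V" "l \<in> L"
  shows "tau (l \<star> v) u w = - tau (l \<star> u) v w"
    and "tau (l \<star> u) w v = - tau (l \<star> u) v w"
    and "tau (l \<star> w) v u = - tau (l \<star> u) v w"
    and "tau (l \<star> v) w u = tau (l \<star> u) v w"
    and "tau (l \<star> w) u v = tau (l \<star> u) v w"
proof -
  have 1: "tau (l \<star> v) u w = - tau (l \<star> u) v w" if "u \<in> V" "v \<in> V" "w \<in> V" for u v w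
    using that assms(4) tau_swap(1)[of u "l \<star> v" w] by (simp add: tau_balanced)
  have 2: "tau (l \<star> u) w v = - tau (l \<star> u) v w" if "u \<in> V" "v \<in> V" "w \<in> V" for u v w
    using that assms(4) by (intro tau_swap) simp_all
  show "tau (l \<star> v) u w = - tau (l \<star> u) v w" "tau (l \<star> u) w v = - tau (l \<star> u) v w"
    using 1[OF assms(1-3)] 2[OF assms(1-3)] .
  show "tau (l \<star> w) v u = - tau (l \<star> u) v w"
    using 1[OF assms(2,3,1)] 2[OF assms(2,3,1)] 1[OF assms(1-3)] by metis
  show "tau (l \<star> v) w u = tau (l \<star> u) v w"
    using 2[OF assms(2,1,3)] 1[OF assms(1-3)] by (metis minus_minus)
  show "tau (l \<star> w) u v = tau (l \<star> u) v w"
    using 1[OF assms(1,3,2)] 2[OF assms(1-3)] by (metis minus_minus)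
qed

lemma tau_L_mult:
  assumes "u \<in> V" "v \<in> V" "w \<in> V" "l \<in> L" "m \<in> L" "n \<in> L"
  shows "tau (l \<star> u) (m \<star> v) (n \<star> w) = tau (l \<star> m \<star> n \<star> u) v w"
proof -
  have "tau (l \<star> u) (m \<star> v) (n \<star> w) = tau (n \<star> (l \<star> u)) (m \<star> v) w"
    by (rule tau_balanced) (use assms in simp_all)
  also have "\<dots> = tau (m \<star> (n \<star> (l \<star> u))) v w"
    by (rule tau_balanced) (use assms in simp_all)
  also have "m \<star> (n \<star> (l \<star> u)) = m \<star> n \<star> l \<star> u"
    using assms by (simp add: L_act_assoc)
  also have "m \<star> n \<star> l = l \<star> (m \<star> n)"
    using assms by (intro L_commute) simp_all
  also have "l \<star> (m \<star> n) = l \<star> m \<star> n"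
    using assms by (simp add: L_act_assoc)
  finally show ?thesis .
qed

text \<open>For entries in \<open>L\<close>, which is commutative and associative, this is the
  ordinary determinant. The factors are ordered by column, as the expansion of \<open>tau\<close>
  produces them.\<close>

definition det3 :: "(nat \<Rightarrow> nat \<Rightarrow> 'c) \<Rightarrow> 'c" where
  "det3 a = a 0 0 \<star> a 1 1 \<star> a 2 2 + a 1 0 \<star> a 2 1 \<star> a 0 2 + a 2 0 \<star> a 0 1 \<star> a 1 2
    - a 2 0 \<star> a 1 1 \<star> a 0 2 - a 1 0 \<star> a 0 1 \<star> a 2 2 - a 0 0 \<star> a 2 1 \<star> a 1 2"

text \<open>Multilinear expansion gives 27 terms. Those with a repeated vector vanish, and the six
  others are reordered to \<open>x 0\<close>, \<open>x 1\<close>, \<open>x 2\<close> with their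
  signs.\<close>

lemma tau_det3:
  assumes x: "x 0 \<in> V" "x 1 \<in> V" "x 2 \<in> V" and a: "\<And>i j. i < 3 \<Longrightarrow> j < 3 \<Longrightarrow> a i j \<in> L"
  shows "tau (a 0 0 \<star> x 0 + a 1 0 \<star> x 1 + a 2 0 \<star> x 2) (a 0 1 \<star> x 0 + a 1 1 \<star> x 1 + a 2 1 \<star> x 2)
      (a 0 2 \<star> x 0 + a 1 2 \<star> x 1 + a 2 2 \<star> x 2) = tau (det3 a \<star> x 0) (x 1) (x 2)"
proof -
  have a': "a 0 0 \<in> L" "a 0 1 \<in> L" "a 0 2 \<in> L" "a 1 0 \<in> L" "a 1 1 \<in> L" "a 1 2 \<in> L"
    "a 2 0 \<in> L" "a 2 1 \<in> L" "a 2 2 \<in> L"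
    by (simp_all add: a)
  define p q r where "p = x 0" and "q = x 1" and "r = x 2"
  have V: "p \<in> V" "q \<in> V" "r \<in> V" using x by (simp_all add: p_def q_def r_def)
  note swap = tau_L_swap[OF V]
  have zero: "tau (l \<star> p) p w = 0" "tau (l \<star> p) w p = 0" "tau (l \<star> w) p p = 0"
    "tau (l \<star> q) q w = 0" "tau (l \<star> q) w q = 0" "tau (l \<star> w) q q = 0"
    "tau (l \<star> r) r w = 0" "tau (l \<star> r) w r = 0" "tau (l \<star> w) r r = 0"
    if "l \<in> L" "w \<in> V" for l w
    using that V by (simp_all add: tau_L_repeat)
  show ?thesis
    unfolding p_def[symmetric] q_def[symmetric] r_def[symmetric]
    by (simp only: tau_linear tau_L_mult V a' zero swap L_mult add_0 add_0_right det3_def pr_linear)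
      (simp add: algebra_simps)
qed

end

section \<open>Orthogonal frames of \<open>V\<close> over \<open>L\<close>\<close>

locale octonion_frame = octonion_quadratic scale pr e N y
  for scale :: "'k::field \<Rightarrow> 'c::ab_group_add \<Rightarrow> 'c" (infixr "*s" 75)
    and pr :: "'c \<Rightarrow> 'c \<Rightarrow> 'c" (infixl "\<star>" 70) and e :: 'c and N :: "'c \<Rightarrow> 'k" and y :: 'c +
  fixes v1 v2 :: 'c
  assumes v1_V [simp]: "v1 \<in> V" and v2_V [simp]: "v2 \<in> V"
    and N_v1 [simp]: "N v1 \<noteq> 0" and N_v2 [simp]: "N v2 \<noteq> 0"
    and h_v1_v2: "h v1 v2 = 0"
begin

text \<open>The product completes two \<open>h\<close>-orthogonal vectors to a frame: up to sign,
  its pairings with them over \<open>L\<close> are values of \<open>tau\<close> with a repeated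
  argument.\<close>

definition v3 :: 'c where "v3 = v1 \<star> v2"

lemma h_v2_v1: "h v2 v1 = 0"
  using h_v1_v2 by (rule h_eq_0_commute)

lemma B_v1_v2: "B v1 v2 = 0" "B v1 (y \<star> v2) = 0"
  using h_v1_v2 by (simp_all add: h_eq_0_iff)

text \<open>Orthogonality of \<open>v3\<close> to \<open>e\<close> and to \<open>y\<close> amounts
  to the two scalar conditions contained in \<open>h v1 v2 = 0\<close>.\<close>

lemma v3_V [simp]: "v3 \<in> V"
proof (rule V_I)
  show "B v3 e = 0" "B v3 y = 0"
    by (simp_all add: v3_def B_adjoint_right conj_V pr_linear unit_left B_linear B_v1_v2)
qed

lemma N_v3 [simp]: "N v3 \<noteq> 0"
  by (simp add: v3_def norm_mult)

lemma h_v_v3: "h v1 v3 = 0" "h v2 v3 = 0"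
proof -
  have *: "h u v3 = 0" if "tau u v1 v2 = 0" "tau (y \<star> u) v1 v2 = 0" for u
    using that by (simp add: h_eq_0_iff tau_def v3_def B_adjoint_left pr_linear B_linear)
  show "h v1 v3 = 0" "h v2 v3 = 0"
    by (rule *; simp add: tau_L_repeat tau_eq_0)+
qed

lemma h_v3_v: "h v3 v1 = 0" "h v3 v2 = 0"
  using h_v_v3[THEN h_eq_0_commute] by blast+

lemmas h_frame = h_v1_v2 h_v2_v1 h_v_v3 h_v3_v h_self

definition L_basis :: "'c set" where
  "L_basis = {e, y, v1, y \<star> v1, v2, y \<star> v2, v3, y \<star> v3}"

lemma N_y_mult: "N v \<noteq> 0 \<Longrightarrow> N (y \<star> v) \<noteq> 0"
  by (simp add: norm_mult)

lemma B_of_h: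
  assumes "h x w = 0"
  shows "B x w = 0" "B (y \<star> x) w = 0" "B x (y \<star> w) = 0" "B (y \<star> x) (y \<star> w) = 0"
  using assms B_L_mult_h[of e e x w] B_L_mult_h[of y e x w] B_L_mult_h[of e y x w] B_L_mult_h[of y y x w]
  by (simp_all add: unit_left)

lemma B_y_self: "B v (y \<star> v) = 0" "B (y \<star> v) v = 0"
  using B_mult_right[of e v y] B_mult_right[of y v e] by (simp_all add: unit_left)

lemma L_basis: "orthogonal_family L_basis" "card L_basis = 8"
proof -
  note B_0 = B_of_h[OF h_v1_v2] B_of_h[OF h_v2_v1] B_of_h[OF h_v_v3(1)] B_of_h[OF h_v_v3(2)]
    B_of_h[OF h_v3_v(1)] B_of_h[OF h_v3_v(2)] B_y_self
  \<comment> \<open>The basis is built one vector at a time: an anisotropic vector orthogonal to its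
    predecessors is new, so the cardinality is obtained along with orthogonality.\<close>
  have 0: "orthogonal_family {} \<and> card {} = 0" by (simp add: orthogonal_family_empty)
  have 1: "orthogonal_family {e} \<and>
      card {e} = 1"
    using orthogonal_family_step[OF 0, of "e"] by (simp add: B_0 N_y_mult)
  have 2: "orthogonal_family {y, e} \<and>
      card {y, e} = 2"
    using orthogonal_family_step[OF 1, of "y"] by (simp add: B_0 N_y_mult)
  have 3: "orthogonal_family {v1, y, e} \<and>
      card {v1, y, e} = 3"
    using orthogonal_family_step[OF 2, of "v1"] by (simp add: B_0 N_y_mult)
  have 4: "orthogonal_family {y \<star> v1, v1, y, e} \<and>
      card {y \<star> v1, v1, y, e} = 4"
    using orthogonal_family_step[OF 3, of "y \<star> v1"] by (simp add: B_0 N_y_mult)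
  have 5: "orthogonal_family {v2, y \<star> v1, v1, y, e} \<and>
      card {v2, y \<star> v1, v1, y, e} = 5"
    using orthogonal_family_step[OF 4, of "v2"] by (simp add: B_0 N_y_mult)
  have 6: "orthogonal_family {y \<star> v2, v2, y \<star> v1, v1, y, e} \<and>
      card {y \<star> v2, v2, y \<star> v1, v1, y, e} = 6"
    using orthogonal_family_step[OF 5, of "y \<star> v2"] by (simp add: B_0 N_y_mult)
  have 7: "orthogonal_family {v3, y \<star> v2, v2, y \<star> v1, v1, y, e} \<and>
      card {v3, y \<star> v2, v2, y \<star> v1, v1, y, e} = 7"
    using orthogonal_family_step[OF 6, of "v3"] by (simp add: B_0 N_y_mult)
  have 8: "orthogonal_family {y \<star> v3, v3, y \<star> v2, v2, y \<star> v1, v1, y, e} \<and>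
      card {y \<star> v3, v3, y \<star> v2, v2, y \<star> v1, v1, y, e} = 8"
    using orthogonal_family_step[OF 7, of "y \<star> v3"] by (simp add: B_0 N_y_mult)
  have eq: "L_basis = {y \<star> v3, v3, y \<star> v2, v2, y \<star> v1, v1, y, e}"
    unfolding L_basis_def by blast
  show "orthogonal_family L_basis" "card L_basis = 8"
    using 8 unfolding eq by blast+
qed

lemma eq_0_of_frame:
  assumes "x \<in> V" "h x v1 = 0" "h x v2 = 0" "h x v3 = 0"
  shows "x = 0"
proof -
  have "\<forall>s\<in>L_basis. B x s = 0"
    using assms by (simp add: L_basis_def h_eq_0_iff)
  then have "(\<Sum>s\<in>L_basis. (B x s / (2 * N s)) *s s) = 0"
    by (intro sum.neutral) simp
  with orthogonal_expansion[OF L_basis, of x] show ?thesis by (rule trans)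
qed

definition coord :: "'c \<Rightarrow> 'c \<Rightarrow> 'c" where "coord x v = (1 / N v) *s h x v"

lemma coord_L [simp]: "coord x v \<in> L"
  by (simp add: coord_def)

lemma h_diff: "h (x - x') w = h x w - h x' w"
  by (intro h_eqI) (simp_all add: B_h B_linear)

lemma h_coord: "h (coord x v \<star> v) w = (1 / N v) *s (h x v \<star> h v w)"
  by (simp add: h_L_mult) (simp add: coord_def pr_linear)

lemma frame_expansion:
  assumes "x \<in> V"
  shows "x = coord x v1 \<star> v1 + coord x v2 \<star> v2 + coord x v3 \<star> v3"
proof -
  let ?s = "coord x v1 \<star> v1 + coord x v2 \<star> v2 + coord x v3 \<star> v3"
  have "h ?s v1 = h x v1" "h ?s v2 = h x v2" "h ?s v3 = h x v3"
    by (simp_all add: h_add h_coord h_frame pr_linear unit_right)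
  then have "x - ?s = 0"
    using eq_0_of_frame[of "x - ?s"] assms by (simp add: h_diff)
  then show ?thesis by (rule eq_iff_diff_eq_0[THEN iffD2])
qed

text \<open>
  \<open>g\<close> below is the alternating \<open>L\<close>-bilinear form attached to \<open>K\<close>.  In rank 3 such a form has the kernel
  vector \<open>z\<close>, the analogue of the cross product.
\<close>

lemma ex_skew_kernel:
  assumes add: "\<And>u v. K (u + v) = K u + K v" and scale: "\<And>a u. K (a *s u) = a *s K u"
    and skew: "\<And>u v. B (K u) v = - B u (K v)"
    and K_y: "\<And>u. u \<in> V \<Longrightarrow> K (y \<star> u) = - (y \<star> K u)"
    and K_V: "\<And>u. u \<in> V \<Longrightarrow> K u \<in> V"
  shows "\<exists>u\<in>V. u \<noteq> 0 \<and> K u = 0"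
proof -
  define f where "f u v = B (K u) v" for u v
  have f_linear: "f (u + u') v = f u v + f u' v" "f (a *s u) v = a * f u v"
    "f u (v + v') = f u v + f u v'" "f u (a *s v) = a * f u v" "f u (- v) = - f u v"
    "f (u - u') v = f u v - f u' v" "f (- u) v = - f u v" for a u u' v v'
    using scale[of "-1"] add[of u "-1 *s u'"] by (simp_all add: f_def add scale B_linear)
  have f_swap: "f v u = - f u v" for u v
    unfolding f_def skew[of v u] by (simp add: B_commute)
  have f_self: "f u u = 0" for u
  proof -
    have "2 * f u u = 0" using f_swap[of u u] by (metis add.right_inverse mult_2)
    then show ?thesis by simp
  qed
  \<comment> \<open>Two signs cancel: \<open>K\<close> anticommutes with \<open>y\<close>, and the
    adjoint of left multiplication by \<open>y\<close> is its negative.\<close>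
  have f_y: "f (y \<star> u) v = f u (y \<star> v)" if "u \<in> V" for u v
    using that by (simp add: f_def K_y B_adjoint_left pr_linear B_linear)
  have f_y_swap: "f v (y \<star> u) = - f u (y \<star> v)" if "u \<in> V" for u v
    using f_swap[of "y \<star> u" v] f_y[OF that] by simp
  have f_y_self: "f u (y \<star> u) = 0" if "u \<in> V" for u
  proof -
    have "2 * f u (y \<star> u) = 0"
      using f_y_swap[OF that, of u] by (metis add.right_inverse mult_2)
    then show ?thesis by simp
  qed
  note swap = f_swap[of v1 v2] f_swap[of v1 v3] f_swap[of v2 v3]
    f_y_swap[OF v1_V, of v2] f_y_swap[OF v1_V, of v3] f_y_swap[OF v2_V, of v3]
  \<comment> \<open>With \<open>f u v\<close> as coefficient of \<open>y\<close> and
    \<open>f u (y \<star> v)\<close> as coefficient of \<open>e\<close>, replacing \<open>u\<close>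
    in \<open>V\<close> by \<open>y \<star> u\<close> multiplies the value by
    \<open>y\<close>.\<close>
  define g where "g u v = f u (y \<star> v) *s e + f u v *s y" for u v
  define z where "z = g v2 v3 \<star> v1 + (- g v1 v3) \<star> v2 + g v1 v2 \<star> v3"
  have zL: "g u v \<in> L" for u v by (simp add: g_def)
  have "z \<in> V" by (simp add: z_def zL)
  have f_g: "f (g u v \<star> w) x = f u (y \<star> v) * f w x + f u v * f w (y \<star> x)"
    "f ((- g u v) \<star> w) x = - (f u (y \<star> v) * f w x + f u v * f w (y \<star> x))" if "w \<in> V" for u v w x
    using that by (simp_all add: g_def pr_linear unit_left f_linear f_y)
  show ?thesis
  proof (cases "z = 0")
    case False
    have "f z v1 = 0" "f z v2 = 0" "f z v3 = 0"
        "f z (y \<star> v1) = 0" "f z (y \<star> v2) = 0" "f z (y \<star> v3) = 0"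
      by (simp_all add: z_def f_linear f_g f_self f_y_self swap)
    then have "K z = 0"
      by (simp add: eq_0_of_frame \<open>z \<in> V\<close> h_eq_0_iff f_def K_V)
    then show ?thesis using False \<open>z \<in> V\<close> by blast
  next
    \<comment> \<open>If the cross product degenerates, its coefficients \<open>g v1 v3\<close> and
      \<open>g v1 v2\<close> vanish, and \<open>v1\<close> itself lies in the kernel.\<close>
    case True
    have "h z v2 = - (N v2 *s g v1 v3)" "h z v3 = N v3 *s g v1 v2"
      by (simp_all add: z_def h_add h_diff h_L_mult zL h_frame pr_linear unit_right)
    moreover have "h z w = 0" for w using True by (simp add: h_def)
    ultimately have "g v1 v3 = 0" "g v1 v2 = 0" by simp_all
    then have g: "B (g v1 v3) e = 0" "B (g v1 v3) y = 0" "B (g v1 v2) e = 0" "B (g v1 v2) y = 0"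
      by simp_all
    have "f v1 v2 = 0" "f v1 (y \<star> v2) = 0" "f v1 v3 = 0" "f v1 (y \<star> v3) = 0"
      using g by (simp_all add: g_def B_linear B_self)
    then have "K v1 = 0"
      by (simp add: eq_0_of_frame h_eq_0_iff f_def[symmetric] K_V f_self f_y_self)
    moreover have "v1 \<noteq> 0" using N_v1 N_zero by metis
    ultimately show ?thesis using v1_V by blast
  qed
qed

end

context octonion_quadratic
begin

text \<open>Anisotropic vectors orthogonal to a given family exist as long as it has fewer than 8
  members. Making \<open>v2\<close> orthogonal to \<open>y \<star> v1\<close> as well as to
  \<open>v1\<close> gives orthogonality for \<open>h\<close>.\<close>

lemma ex_frame: "\<exists>v1 v2. octonion_frame scale pr e N y v1 v2"
proof -
  have 0: "orthogonal_family {} \<and> card {} = 0" by (simp add: orthogonal_family_empty)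
  have 1: "orthogonal_family {e} \<and> card {e} = Suc 0"
    using orthogonal_family_step[OF 0, of e] by simp
  have 2: "orthogonal_family {y, e} \<and> card {y, e} = Suc (Suc 0)"
    using orthogonal_family_step[OF 1, of y] by simp
  obtain v1 where v1: "N v1 \<noteq> 0" "B v1 y = 0" "B v1 e = 0"
    using ex_anisotropic_orthogonal_card[of "{y, e}"] 2 by auto
  then have V1: "v1 \<in> V" by (intro V_I)
  have 3: "orthogonal_family {v1, y, e} \<and> card {v1, y, e} = Suc (Suc (Suc 0))"
    using orthogonal_family_step[OF 2, of v1] v1 by simp
  have "B (y \<star> v1) v1 = 0"
    using B_mult_right[of y v1 e] by (simp add: unit_left)
  then have "orthogonal_family {y \<star> v1, v1, y, e} \<and> card {y \<star> v1, v1, y, e} = Suc (Suc (Suc (Suc 0)))"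
    using orthogonal_family_step[OF 3, of "y \<star> v1"] v1 V1 by (simp add: norm_mult)
  then obtain v2 where v2: "N v2 \<noteq> 0" "B v2 (y \<star> v1) = 0" "B v2 v1 = 0" "B v2 y = 0" "B v2 e = 0"
    using ex_anisotropic_orthogonal_card[of "{y \<star> v1, v1, y, e}"] by auto
  have "v2 \<in> V" using v2 by (intro V_I)
  moreover have "h v1 v2 = 0"
    using v2 by (intro h_eq_0_commute[of v2 v1]) (simp add: h_eq_0_iff)
  ultimately have "octonion_frame scale pr e N y v1 v2"
    using v1 v2 V1 by unfold_locales
  then show ?thesis by blast
qed

end

section \<open>Semisimple endomorphisms and eigenvectors\<close>

text \<open>Diagonalizability over the closure is used through \<open>Z\<close>, an injective
  coordinate map on which \<open>f\<close> acts by the scalars \<open>d i\<close>.\<close>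

lemma (in vector_space) semisimple_eigen_coordinates:
  assumes f: "Vector_Spaces.linear scale scale f" and "semisimple_endomorphism scale f"
  obtains n :: nat and Z :: "'b \<Rightarrow> 'a alg_closure vec" and d :: "nat \<Rightarrow> 'a alg_closure"
  where "\<And>x y. Z (x - y) = Z x - Z y" "\<And>a x. Z (scale a x) = to_ac a \<cdot>\<^sub>v Z x"
    "\<And>x. Z x \<in> carrier_vec n"
    "\<And>x i. i < n \<Longrightarrow> Z (f x) $ i = d i * Z x $ i" "\<And>x. Z x = 0\<^sub>v n \<Longrightarrow> x = 0"
proof -
  from assms(2) obtain bs D where bs: "distinct bs" "independent (set bs)" "span (set bs) = UNIV"
    and D: "diagonal_mat D" "similar_mat (map_mat to_ac (matrix_of scale bs f)) D"
    unfolding semisimple_endomorphism_def by blast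
  interpret f: Vector_Spaces.linear scale scale f by (rule f)
  define n where "n = length bs"
  define M where "M = matrix_of scale bs f"
  have M: "M \<in> carrier_mat n n" by (simp add: M_def matrix_of_def n_def)
  define r where "r x = vec n (\<lambda>i. representation (set bs) x (bs ! i))" for x
  have r_carrier [simp]: "r x \<in> carrier_vec n" for x by (simp add: r_def)
  have r_dim [simp]: "dim_vec (r x) = n" for x by (simp add: r_def)
  have expand: "x = (\<Sum>j<n. scale (representation (set bs) x (bs ! j)) (bs ! j))" for x
  proof -
    have "x = (\<Sum>b\<in>set bs. scale (representation (set bs) x b) b)"
      using bs by (intro sum_representation_eq[symmetric]) auto
    also have "\<dots> = (\<Sum>j<n. scale (representation (set bs) x (bs ! j)) (bs ! j))"
      using bij_betw_nth[OF bs(1) refl refl] unfolding n_def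
      by (intro sum.reindex_bij_betw[symmetric]) (simp add: lessThan_atLeast0)
    finally show ?thesis .
  qed
  have r_f: "r (f x) = M *\<^sub>v r x" for x
  proof (rule eq_vecI)
    fix i assume "i < dim_vec (M *\<^sub>v r x)"
    then have i: "i < n" using M by simp
    have "f x = (\<Sum>j<n. scale (representation (set bs) x (bs ! j)) (f (bs ! j)))"
      by (subst expand[of x]) (simp add: f.sum f.scale)
    then have "representation (set bs) (f x) (bs ! i) =
        (\<Sum>j<n. representation (set bs) x (bs ! j) * representation (set bs) (f (bs ! j)) (bs ! i))"
      by (simp add: representation_sum representation_scale bs)
    also have "\<dots> = (M *\<^sub>v r x) $ i"
      using i M by (auto simp: scalar_prod_def r_def M_def matrix_of_def n_def lessThan_atLeast0
        intro!: sum.cong)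
    finally show "r (f x) $ i = (M *\<^sub>v r x) $ i" using i by (simp add: r_def)
  qed (use M in \<open>simp add: r_def\<close>)
  have r_0: "x = 0" if "r x = 0\<^sub>v n" for x
  proof -
    have "representation (set bs) x (bs ! j) = 0" if "j < n" for j
      using \<open>r x = 0\<^sub>v n\<close> that by (metis r_def index_vec index_zero_vec(1))
    then show ?thesis using expand[of x] by simp
  qed
  define M' where "M' = map_mat to_ac M"
  have M': "M' \<in> carrier_mat n n" using M by (simp add: M'_def)
  obtain P Q where PQ: "P \<in> carrier_mat n n" "Q \<in> carrier_mat n n" "D \<in> carrier_mat n n"
    "P * Q = 1\<^sub>m n" "Q * P = 1\<^sub>m n" "M' = P * D * Q"
    using similar_matD[OF D(2)] M' unfolding M_def[symmetric] M'_def[symmetric]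
    by (metis carrier_matD(1) insert_subset)
  \<comment> \<open>Since \<open>M' = P * D * Q\<close> with \<open>Q\<close> inverse to
    \<open>P\<close>, applying \<open>Q\<close> passes from coordinates in \<open>bs\<close> to
    coordinates in the eigenbasis.\<close>
  define Z where "Z x = Q *\<^sub>v map_vec to_ac (r x)" for x
  show thesis
  proof (rule that[of Z n "\<lambda>i. D $$ (i, i)"])
    show "Z x \<in> carrier_vec n" for x using PQ by (simp add: Z_def)
    have "map_vec to_ac (r (x - y)) = map_vec to_ac (r x) - map_vec to_ac (r y)" for x y
      by (rule eq_vecI) (simp_all add: r_def representation_diff bs)
    then show "Z (x - y) = Z x - Z y" for x y
      using PQ by (simp add: Z_def mult_minus_distrib_mat_vec[of _ n n])
    have "map_vec to_ac (r (scale a x)) = to_ac a \<cdot>\<^sub>v map_vec to_ac (r x)" for a x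
      by (rule eq_vecI) (simp_all add: r_def representation_scale bs)
    then show "Z (scale a x) = to_ac a \<cdot>\<^sub>v Z x" for a x
      using PQ by (simp add: Z_def mult_mat_vec[of _ n n])
    have ac: "map_vec to_ac (r (f x)) = M' *\<^sub>v map_vec to_ac (r x)" for x
      by (rule eq_vecI)
        (use M in \<open>simp_all add: r_f M'_def scalar_prod_def to_ac_sum\<close>)
    have Z_f: "Z (f x) = D *\<^sub>v Z x" for x
    proof -
      have "Z (f x) = Q *\<^sub>v ((P * D * Q) *\<^sub>v map_vec to_ac (r x))"
        by (simp add: Z_def ac PQ)
      also have "\<dots> = (Q * (P * D * Q)) *\<^sub>v map_vec to_ac (r x)"
        using PQ by (intro assoc_mult_mat_vec[symmetric, of _ n n _ n]) auto
      also have "P * D * Q = P * (D * Q)"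
        using PQ by (intro assoc_mult_mat[of _ n n _ n _ n]) auto
      also have "Q * (P * (D * Q)) = (Q * P) * (D * Q)"
        using PQ by (intro assoc_mult_mat[symmetric, of _ n n _ n _ n]) auto
      also have "\<dots> = D * Q" using PQ by (simp add: left_mult_one_mat[of _ n n])
      also have "(D * Q) *\<^sub>v map_vec to_ac (r x) = D *\<^sub>v Z x"
        unfolding Z_def using PQ by (intro assoc_mult_mat_vec[of _ n n _ n]) auto
      finally show ?thesis .
    qed
    show "Z (f x) $ i = D $$ (i, i) * Z x $ i" if i: "i < n" for x i
    proof -
      have "dim_vec (Z x) = n" using PQ by (simp add: Z_def)
      then have "Z (f x) $ i = (\<Sum>j = 0..<n. D $$ (i, j) * Z x $ j)"
        using PQ i by (simp add: Z_f scalar_prod_def)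
      also have "\<dots> = (\<Sum>j = 0..<n. if j = i then D $$ (i, i) * Z x $ i else 0)"
        using D(1) PQ i by (intro sum.cong) (auto simp: diagonal_mat_def)
      also have "\<dots> = D $$ (i, i) * Z x $ i" using i by simp
      finally show ?thesis .
    qed
    show "x = 0" if "Z x = 0\<^sub>v n" for x
    proof -
      have "map_vec to_ac (r x) = (P * Q) *\<^sub>v map_vec to_ac (r x)"
        using PQ by (simp add: one_mult_mat_vec[of _ n])
      also have "\<dots> = P *\<^sub>v Z x"
        unfolding Z_def using PQ by (intro assoc_mult_mat_vec[of _ n n _ n]) auto
      also have "\<dots> = 0\<^sub>v n"
        using PQ that by (intro eq_vecI) (auto simp: scalar_prod_def)
      finally have *: "map_vec to_ac (r x) = 0\<^sub>v n" .
      have "r x = 0\<^sub>v n"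
      proof (rule eq_vecI)
        fix i assume "i < dim_vec (0\<^sub>v n :: 'a vec)"
        then have "to_ac (r x $ i) = 0"
          using arg_cong[OF *, of "\<lambda>v. vec_index v i"] by simp
        then show "r x $ i = 0\<^sub>v n $ i" using \<open>i < _\<close> by simp
      qed (simp add: r_def)
      then show "x = 0" by (rule r_0)
    qed
  qed
qed

text \<open>There are no Jordan blocks: in each eigencoordinate the hypothesis says that the square
  of \<open>d i - to_ac c\<close> kills the entry, so \<open>d i - to_ac c\<close> already
  does.\<close>

lemma (in vector_space) semisimple_eigenvector:
  assumes f: "Vector_Spaces.linear scale scale f" and "semisimple_endomorphism scale f"
    and u: "f (f x - scale c x) = scale c (f x - scale c x)"
  shows "f x = scale c x"
proof -
  obtain n and Z :: "'b \<Rightarrow> 'a alg_closure vec" and d where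
    Z: "\<And>x y. Z (x - y) = Z x - Z y" "\<And>a x. Z (scale a x) = to_ac a \<cdot>\<^sub>v Z x"
    "\<And>x. Z x \<in> carrier_vec n"
    "\<And>x i. i < n \<Longrightarrow> Z (f x) $ i = d i * Z x $ i" "\<And>x. Z x = 0\<^sub>v n \<Longrightarrow> x = 0"
    using semisimple_eigen_coordinates[OF assms(1,2)] by metis
  let ?u = "f x - scale c x"
  have dim: "dim_vec (Z x) = n" for x using Z(3)[of x] by auto
  have Zu: "Z ?u $ i = (d i - to_ac c) * Z x $ i" if "i < n" for i
    using that Z(4)[of i x] dim by (simp add: Z(1,2) algebra_simps)
  have "Z ?u = 0\<^sub>v n"
  proof (rule eq_vecI)
    fix i assume "i < dim_vec (0\<^sub>v n :: 'a alg_closure vec)"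
    then have i: "i < n" by simp
    have "d i * Z ?u $ i = to_ac c * Z ?u $ i"
      unfolding Z(4)[OF i, of ?u, symmetric] unfolding u Z(2)[of c ?u] using i dim[of ?u] by simp
    then have "(d i - to_ac c) * ((d i - to_ac c) * Z x $ i) = 0"
      using Zu[OF i] by (simp add: algebra_simps)
    then show "Z ?u $ i = 0\<^sub>v n $ i"
      unfolding Zu[OF i] using i by (metis index_zero_vec(1) mult_eq_0_iff)
  qed (simp add: dim)
  then show ?thesis using Z(5) by force
qed

section \<open>Automorphisms as isometries\<close>

context composition_algebra_not_char_2
begin

abbreviation aut :: "('c \<Rightarrow> 'c) \<Rightarrow> bool" where
  "aut \<equiv> algebra_automorphism scale pr e"

lemma linear_algebra:
  assumes "Vector_Spaces.linear scale scale f"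
  shows "f (x + y) = f x + f y" "f (a *s x) = a *s f x" "f 0 = 0" "f (- x) = - f x" "f (x - y) = f x - f y"
proof -
  interpret f: Vector_Spaces.linear scale scale f by (rule assms)
  show "f (x + y) = f x + f y" "f (a *s x) = a *s f x" "f 0 = 0" "f (- x) = - f x" "f (x - y) = f x - f y"
    by (simp_all add: f.add f.scale f.zero f.neg f.diff)
qed

lemma linearI:
  assumes "\<And>x y. f (x + y) = f x + f y" "\<And>a x. f (a *s x) = a *s f x"
  shows "Vector_Spaces.linear scale scale f"
  by (unfold_locales) (simp_all add: assms)

lemma autD:
  assumes "aut f"
  shows "bij f" "Vector_Spaces.linear scale scale f" "f e = e" "f (x \<star> y) = f x \<star> f y"
    "f (x + y) = f x + f y" "f (a *s x) = a *s f x" "f 0 = 0" "f (- x) = - f x" "f (x - y) = f x - f y"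
    "f x = f y \<longleftrightarrow> x = y"
  using assms linear_algebra[of f] bij_is_inj[of f, THEN inj_eq, of x y]
  unfolding algebra_automorphism_def by simp_all

text \<open>The norm is determined by the quadratic equation that each element satisfies.\<close>

lemma aut_N:
  assumes f: "aut f"
  shows "N (f x) = N x"
proof -
  have "f x \<star> f x = f (B x e *s x - N x *s e)"
    using mult_self[of x] autD(4)[OF f, of x x] by simp
  then have "B x e *s f x - N x *s e = B (f x) e *s f x - N (f x) *s e"
    using f by (simp add: mult_self[of "f x"] autD)
  then have eq: "(B x e - B (f x) e) *s f x = (N x - N (f x)) *s e"
    by (simp add: algebra_simps)
  show ?thesis
  proof (cases "B x e = B (f x) e")
    case True
    then show ?thesis using eq e_neq_0 by simp
  next
    \<comment> \<open>Here \<open>f x\<close> is a multiple of \<open>e\<close>, hence so is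
      \<open>x\<close>, and such vectors are fixed by \<open>f\<close>.\<close>
    case False
    define c where "c = (N x - N (f x)) / (B x e - B (f x) e)"
    have "(1 / (B x e - B (f x) e)) *s ((B x e - B (f x) e) *s f x) = c *s e"
      unfolding eq by (simp add: c_def)
    then have "f x = c *s e" using False by simp
    then have "f x = f (c *s e)" using f by (simp add: autD)
    then have "x = c *s e" using autD(10)[OF f] by blast
    then show ?thesis using f by (simp add: autD)
  qed
qed

lemma aut_B: "aut f \<Longrightarrow> B (f x) (f y) = B x y"
  using aut_N[of f] by (simp add: polar_def flip: autD(5))

lemma aut_inv: assumes "aut f" shows "aut (inv_into UNIV f)"
proof -
  note f = autD[OF assms]
  have fi: "f (inv_into UNIV f x) = x" for x using f(1) by (simp add: bij_is_surj surj_f_inv_f)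
  have inj: "u = v" if "f u = f v" for u v using that f(10) by blast
  show ?thesis
    unfolding algebra_automorphism_def
  proof (intro conjI allI linearI)
    show "bij (inv_into UNIV f)" using f(1) by (rule bij_imp_bij_inv)
  qed (rule inj; simp only: f(3,4,5,6) fi)+
qed

end

section \<open>Fixed vectors of semisimple automorphisms\<close>

context octonion_algebra_not_char_2
begin

text \<open>The hypothesis makes \<open>T\<close> injective on its range, hence by dimension
  surjective there. So \<open>T x = T (T w)\<close> for some \<open>w\<close>, and
  \<open>x - T w\<close> is in the kernel.\<close>

lemma direct_sum_kernel_range:
  assumes T: "Vector_Spaces.linear scale scale T" and "\<And>x. T (T x) = 0 \<Longrightarrow> T x = 0"
  obtains u w where "T u = 0" "x = u + T w"
proof -
  obtain Bs where "finite Bs" "independent Bs" "span Bs = UNIV"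
    using finite_spanning_set by blast
  then interpret fd: finite_dimensional_vector_space scale Bs
    by unfold_locales auto
  interpret fd2: finite_dimensional_vector_space_pair_1 scale Bs scale
    by unfold_locales
  interpret T: Vector_Spaces.linear scale scale T by (rule T)
  have sub: "subspace (range T)" by (rule T.subspace_image) simp
  have "inj_on T (range T)"
  proof (rule inj_onI)
    fix a b assume "a \<in> range T" "b \<in> range T" "T a = T b"
    then obtain a' b' where "a = T a'" "b = T b'" by blast
    then have "T (T (a' - b')) = 0" using \<open>T a = T b\<close> by (simp add: T.diff)
    then have "T (a' - b') = 0" by (rule assms(2))
    then show "a = b" using \<open>a = _\<close> \<open>b = _\<close> by (simp add: T.diff)
  qed
  then have "dim (T ` range T) = dim (range T)"
    using sub by (intro fd2.dim_image_eq[OF T]) (simp add: span_eq_iff[THEN iffD2])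
  then have "T ` range T = range T"
    using sub T.subspace_image[OF sub] by (intro fd.subspace_dim_equal) auto
  then obtain w where "T x = T (T w)" by blast
  then have "T (x - T w) = 0" by (simp add: T.diff)
  then show thesis by (rule that[of "x - T w" w]) simp
qed

text \<open>As \<open>t\<close> is an isometry and \<open>c * c = 1\<close>, the eigenvector
  \<open>x\<close> is orthogonal to the range of \<open>T = t - c\<close>. If all eigenvectors
  orthogonal to \<open>e\<close> were isotropic, \<open>x\<close> would also be orthogonal to the
  kernel; by semisimplicity kernel and range span everything.\<close>

lemma ex_anisotropic_eigenvector:
  assumes t: "aut t" "semisimple_endomorphism scale t" and c: "c = 1 \<or> c = -1"
    and x: "t x = c *s x" "x \<noteq> 0" "B x e = 0"
  shows "\<exists>z. t z = c *s z \<and> B z e = 0 \<and> N z \<noteq> 0"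
proof (rule ccontr)
  assume no: "\<not> ?thesis"
  define T where "T u = t u - c *s u" for u
  have T: "Vector_Spaces.linear scale scale T"
    by (rule linearI) (simp_all add: T_def autD[OF t(1)] algebra_simps)
  have c2: "c * c = 1" using c by auto
  have B_T: "B x (T w) = 0" for w
  proof -
    have "B x (t w) = c * B (t x) (t w)" by (simp add: x(1) B_linear c2 flip: mult.assoc)
    also have "\<dots> = c * B x w" by (simp add: aut_B[OF t(1)])
    finally show ?thesis by (simp add: T_def B_linear)
  qed
  have B_ker: "B x u = 0" if "t u = c *s u" for u
  proof -
    \<comment> \<open>The component of \<open>u\<close> orthogonal to \<open>e\<close> is still an
      eigenvector: \<open>e\<close> is fixed if \<open>c = 1\<close>, and \<open>B u e = 0\<close>
      if \<open>c = -1\<close>.\<close>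
    define v where "v = u - (B u e / 2) *s e"
    have "B v e = 0" by (simp add: v_def B_linear)
    moreover have "t v = c *s v"
    proof (cases "c = 1")
      case True
      then show ?thesis using that by (simp add: v_def autD[OF t(1)])
    next
      case False
      then have "c = -1" using c by blast
      have "B u e = c * B u e"
        using aut_B[OF t(1), of u e] by (simp add: that autD[OF t(1)] B_linear)
      then have "2 * B u e = 0"
        unfolding \<open>c = -1\<close> by (metis add.right_inverse mult_2 mult_minus1)
      then show ?thesis using that by (simp add: v_def)
    qed
    moreover have "B (x + v) e = 0" "t (x + v) = c *s (x + v)"
      using calculation x by (simp_all add: B_linear autD[OF t(1)] algebra_simps)
    ultimately have "N v = 0" "N (x + v) = 0" "N x = 0"
      using no x by blast+
    then have "B x v = 0" by (simp add: N_add)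
    then show ?thesis using x by (simp add: v_def B_linear)
  qed
  have "B x w = B 0 w" for w
  proof -
    obtain u w' where "T u = 0" "w = u + T w'"
    proof (rule direct_sum_kernel_range[OF T, of w])
      show "T u = 0" if "T (T u) = 0" for u
        using semisimple_eigenvector[OF autD(2)[OF t(1)] t(2), of u c] that
        by (simp add: T_def)
    qed
    then show ?thesis using B_ker[of u] B_T[of w'] by (simp add: B_linear T_def)
  qed
  then have "x = 0" by (rule eq_of_B)
  with x show False by simp
qed

text \<open>\<open>B (K u) v\<close> is alternating on the complement of \<open>e\<close>, whose dimension 7 is odd.\<close>

lemma ex_kernel_of_skew:
  assumes add: "\<And>u v. K (u + v) = K u + K v" and scale: "\<And>a u. K (a *s u) = a *s K u"
    and skew: "\<And>u v. B (K u) v = - B u (K v)" and K_e: "K e = 0"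
  shows "\<exists>x. x \<noteq> 0 \<and> B x e = 0 \<and> K x = 0"
proof -
  have "orthogonal_family {e} \<and> card {e} = Suc 0"
    using orthogonal_family_step[of "{}" 0 e] by (simp add: orthogonal_family_empty)
  then obtain y where "N y \<noteq> 0" "B y e = 0"
    using ex_anisotropic_orthogonal_card[of "{e}"] by auto
  then interpret octonion_quadratic scale pr e N y by unfold_locales
  \<comment> \<open>The frame provides an orthogonal basis of the whole algebra that contains
    \<open>e\<close>.\<close>
  obtain v1 v2 where "octonion_frame scale pr e N y v1 v2" using ex_frame by blast
  then interpret octonion_frame scale pr e N y v1 v2 .
  note S = L_basis
  have fin: "finite L_basis" and e: "e \<in> L_basis" by (simp_all add: L_basis_def)
  have card: "card (L_basis - {e}) = 7" using S fin e by simp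
  obtain b where b: "bij_betw b {0..<7::nat} (L_basis - {e})"
    using ex_bij_betw_nat_finite[of "L_basis - {e}"] fin card by auto
  have b_in: "b i \<in> L_basis" "b i \<noteq> e" if "i < 7" for i
    using bij_betwE[OF b] that by auto
  define A where "A = mat 7 7 (\<lambda>(i, j). B (K (b i)) (b j))"
  have A: "A \<in> carrier_mat 7 7" by (simp add: A_def)
  have "transpose_mat A = (-1) \<cdot>\<^sub>m A"
    by (rule eq_matI) (simp_all add: A_def, metis skew B_commute)
  then have "det A = (-1)^7 * det A"
    using det_transpose[OF A] det_smult[of "-1" A] A by simp
  then have "2 * det A = 0" by (metis add.right_inverse minus_one_power_iff mult_2 mult_minus1 odd_numeral)
  then have "det A = 0" by simp
  then obtain c where c: "c \<in> carrier_vec 7" "c \<noteq> 0\<^sub>v 7" "A *\<^sub>v c = 0\<^sub>v 7"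
    using det_0_iff_vec_prod_zero_field[OF A] by blast
  define x where "x = (\<Sum>j = 0..<7. vec_index c j *s b j)"
  have B_K: "B (K (b i)) x = 0" if "i < 7" for i
  proof -
    have "B (K (b i)) x = vec_index (A *\<^sub>v c) i"
      using that c(1) A
      by (auto simp: x_def A_def scalar_prod_def B_sum_right B_scale_right mult.commute intro!: sum.cong)
    then show ?thesis using c(3) that by simp
  qed
  have "\<forall>s\<in>L_basis. B (K x) s = 0"
  proof
    fix s assume "s \<in> L_basis"
    show "B (K x) s = 0"
    proof (cases "s = e")
      case True
      then show ?thesis by (simp add: skew K_e)
    next
      case False
      then have "s \<in> b ` {0..<7}"
        using b \<open>s \<in> L_basis\<close> by (simp add: bij_betw_def)
      then obtain i where "i < 7" "s = b i" by auto
      then show ?thesis using B_K[of i] skew[of "b i" x] by (simp add: B_commute)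
    qed
  qed
  then have "(\<Sum>s\<in>L_basis. (B (K x) s / (2 * N s)) *s s) = 0"
    by (intro sum.neutral) simp
  with orthogonal_expansion[OF S, of "K x"] have "K x = 0" by (rule trans)
  \<comment> \<open>Pairing with the orthogonal basis recovers the coefficients \<open>c\<close>, so
    \<open>c \<noteq> 0\<^sub>v 7\<close> yields \<open>x \<noteq> 0\<close>.\<close>
  moreover have B_b: "B x (b i) = 2 * N (b i) * vec_index c i" if "i < 7" for i
  proof -
    have "B x (b i) = (\<Sum>j = 0..<7. if j = i then 2 * N (b i) * vec_index c i else 0)"
      unfolding x_def B_sum_left
    proof (rule sum.cong[OF refl])
      fix j assume "j \<in> {0..<7::nat}"
      then have "b j \<noteq> b i" if "j \<noteq> i"
        using b \<open>i < 7\<close> that by (auto simp: bij_betw_def inj_on_def)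
      then show "B (vec_index c j *s b j) (b i) = (if j = i then 2 * N (b i) * vec_index c i else 0)"
        using S(1) b_in[of i] b_in[of j] \<open>i < 7\<close> \<open>j \<in> _\<close>
        by (auto simp: orthogonal_family_def B_linear B_self)
    qed
    then show ?thesis using that by simp
  qed
  moreover have "x \<noteq> 0"
  proof
    assume "x = 0"
    have "c = 0\<^sub>v 7"
    proof (rule eq_vecI)
      fix i assume "i < dim_vec (0\<^sub>v 7 :: 'k vec)"
      then have "i < 7" by simp
      then have "2 * N (b i) * vec_index c i = 0" using B_b[of i] \<open>x = 0\<close> by simp
      moreover have "N (b i) \<noteq> 0" using S(1) b_in[OF \<open>i < 7\<close>] by (simp add: orthogonal_family_def)
      ultimately show "vec_index c i = vec_index (0\<^sub>v 7) i" using \<open>i < 7\<close> by simp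
    qed (use c in simp)
    then show False using c by simp
  qed
  moreover have "B x e = 0"
    unfolding x_def B_sum_left
  proof (rule sum.neutral, rule ballI)
    fix j assume "j \<in> {0..<7::nat}"
    then show "B (vec_index c j *s b j) e = 0"
      using S(1) b_in[of j] e by (simp add: orthogonal_family_def B_linear)
  qed
  ultimately show ?thesis by blast
qed

lemma ex_fixed_anisotropic:
  assumes t: "aut t" "semisimple_endomorphism scale t"
  shows "\<exists>y. t y = y \<and> B y e = 0 \<and> N y \<noteq> 0"
proof -
  \<comment> \<open>The inverse of an isometry is its adjoint, which makes \<open>K\<close>
    skew.\<close>
  define K where "K u = t u - inv_into UNIV t u" for u
  note t' = aut_inv[OF t(1)]
  have t_inv: "t (inv_into UNIV t u) = u" "inv_into UNIV t (t u) = u" for u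
    using autD(1)[OF t(1)] by (simp_all add: bij_is_surj surj_f_inv_f bij_is_inj)
  have add: "K (u + v) = K u + K v" and scale: "K (a *s u) = a *s K u" for a u v
    by (simp_all add: K_def autD[OF t(1)] autD[OF t'] algebra_simps)
  have skew: "B (K u) v = - B u (K v)" for u v
    using aut_B[OF t(1), of u "inv_into UNIV t v"] aut_B[OF t(1), of "inv_into UNIV t u" v]
    by (simp add: K_def B_linear t_inv)
  have K_0: "t (t u) = u" if "K u = 0" for u
    using that t_inv(1)[of u] by (simp add: K_def)
  have "\<exists>x. x \<noteq> 0 \<and> B x e = 0 \<and> t x = x"
  proof (rule ccontr)
    assume no: "\<not> ?thesis"
    \<comment> \<open>The vector \<open>u + t u\<close> is fixed by \<open>t\<close> and orthogonal
      to \<open>e\<close>, hence zero under the assumption \<open>no\<close>.\<close>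
    have minus: "t u = - u" if "t (t u) = u" "B u e = 0" for u
    proof -
      have "t (u + t u) = u + t u" using that by (simp add: autD[OF t(1)] add.commute)
      moreover have "B (u + t u) e = 0"
        using that aut_B[OF t(1), of u e] by (simp add: B_linear autD[OF t(1)])
      ultimately have "u + t u = 0" using no by blast
      then show ?thesis by (simp add: eq_neg_iff_add_eq_0 add.commute)
    qed
    have "K e = 0"
      using t_inv(2)[of e] by (simp add: K_def autD[OF t(1)])
    then obtain x where x: "x \<noteq> 0" "B x e = 0" "K x = 0"
      using ex_kernel_of_skew[of K] add scale skew by blast
    then have "t x = (-1) *s x" using minus[OF K_0] by simp
    then obtain y where y: "t y = - y" "B y e = 0" "N y \<noteq> 0"
      using ex_anisotropic_eigenvector[OF t, of "-1" x] x by auto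
    interpret octonion_quadratic scale pr e N y
      using y by unfold_locales
    obtain v1 v2 where "octonion_frame scale pr e N y v1 v2" using ex_frame by blast
    then interpret octonion_frame scale pr e N y v1 v2 .
    have inv_y: "inv_into UNIV t y = - y"
      using t_inv(2)[of "- y"] y by (simp add: autD[OF t(1)])
    have "K (y \<star> u) = - (y \<star> K u)" for u
      by (simp add: K_def autD[OF t(1)] autD[OF t'] y(1) inv_y pr_linear)
    moreover have "K u \<in> V" if "u \<in> V" for u
    proof (rule V_I)
      show "B (K u) e = 0" "B (K u) y = 0"
        using that \<open>K e = 0\<close> by (simp_all add: skew K_def[of y] y(1) inv_y)
    qed
    ultimately obtain u where u: "u \<in> V" "u \<noteq> 0" "K u = 0"
      using ex_skew_kernel[of K] add scale skew by blast
    then have "t u = - u" by (intro minus[OF K_0]) simp_all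
    then have "t (y \<star> u) = y \<star> u"
      using y by (simp add: autD[OF t(1)] pr_linear)
    \<comment> \<open>Multiplying by \<open>y\<close> again gives \<open>- (N y *s u)\<close>, which
      is nonzero.\<close>
    moreover have "y \<star> u \<noteq> 0"
    proof
      assume "y \<star> u = 0"
      then have "y \<star> (y \<star> u) = 0" by (simp only: pr_zero_right)
      then show False using u by simp
    qed
    moreover have "B (y \<star> u) e = 0" using u(1) by simp
    ultimately show False using no by blast
  qed
  then show ?thesis
    using ex_anisotropic_eigenvector[OF t, of 1] by auto
qed

end

section \<open>Automorphisms fixing a quadratic subalgebra\<close>

context octonion_quadratic
begin

lemma quadratic_etale_L: "quadratic_etale_subalgebra scale pr e N L"
  unfolding quadratic_etale_subalgebra_def subalgebra_def
proof (intro conjI ballI)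
  have 1: "orthogonal_family {e} \<and> card {e} = Suc 0"
    using orthogonal_family_step[of "{}" 0 e] by (simp add: orthogonal_family_empty)
  have 2: "orthogonal_family {y, e} \<and> card {y, e} = 2"
    using orthogonal_family_step[OF 1, of y] by simp
  have "span {y, e} = L"
  proof
    show "span {y, e} \<subseteq> L" by (rule span_minimal) (simp_all add: L_subspace)
    show "L \<subseteq> span {y, e}"
      by (auto elim!: LE intro!: span_add span_scale intro: span_base)
  qed
  then show "dim L = 2"
    using 2 dim_span_eq_card_independent[OF orthogonal_family_independent, of "{y, e}"] by simp
  show "nondegenerate_on N L"
    unfolding nondegenerate_on_def by (intro ballI impI L_eqI) simp_all
qed (simp_all add: L_subspace)

lemma aut_L_mult:
  assumes "aut f" "\<forall>l\<in>L. f l = l" "l \<in> L"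
  shows "f (l \<star> x) = l \<star> f x"
  using assms by (simp add: autD)

lemma aut_V_iff:
  assumes "aut f" "\<forall>l\<in>L. f l = l"
  shows "f v \<in> V \<longleftrightarrow> v \<in> V"
proof -
  have "B (f v) l = B v l" if "l \<in> L" for l
    using that aut_B[OF assms(1), of v l] assms(2) by simp
  then show ?thesis unfolding V_iff by simp
qed

lemma aut_V: "aut f \<Longrightarrow> \<forall>l\<in>L. f l = l \<Longrightarrow> v \<in> V \<Longrightarrow> f v \<in> V"
  by (simp only: aut_V_iff)

lemma aut_bij_V:
  assumes "aut f" "\<forall>l\<in>L. f l = l"
  shows "bij_betw f V V"
proof (rule bij_betw_imageI)
  show "inj_on f V" using autD(10)[OF assms(1)] by (auto simp: inj_on_def)
  show "f ` V = V"
  proof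
    show "V \<subseteq> f ` V"
    proof
      fix v assume "v \<in> V"
      moreover obtain u where "v = f u" using autD(1)[OF assms(1)] by (metis bij_pointE)
      ultimately show "v \<in> f ` V" using aut_V_iff[OF assms] by blast
    qed
  qed (use aut_V[OF assms] in auto)
qed

lemma aut_tau:
  assumes "aut f"
  shows "tau (f u) (f v) (f w) = tau u v w"
  using assms by (simp add: tau_def aut_B flip: autD(4))

lemma aut_h:
  assumes "aut f" "\<forall>l\<in>L. f l = l"
  shows "h (f x) (f w) = h x w"
  using aut_B[OF assms(1), of x w] aut_B[OF assms(1), of x "y \<star> w"] aut_L_mult[OF assms y_in_L, of w]
  by (simp add: h_def)

definition proj_L :: "'c \<Rightarrow> 'c" where
  "proj_L x = (B x e / 2) *s e + (B x y / (2 * N y)) *s y"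

definition proj_V :: "'c \<Rightarrow> 'c" where "proj_V x = x - proj_L x"

lemma proj_L_in [simp]: "proj_L x \<in> L"
  by (simp add: proj_L_def)

lemma proj_V_in [simp]: "proj_V x \<in> V"
  by (rule V_I) (simp_all add: proj_V_def proj_L_def B_linear B_self)

lemma proj_unique:
  assumes "l \<in> L" "v \<in> V"
  shows "proj_L (l + v) = l" "proj_V (l + v) = v"
proof -
  obtain a b where l: "l = a *s e + b *s y" using assms by (metis LE)
  have "B v e = 0" "B v y = 0" using assms by simp_all
  then show "proj_L (l + v) = l" by (simp add: proj_L_def l B_linear B_self)
  then show "proj_V (l + v) = v" by (simp add: proj_V_def)
qed

lemma proj_sum: "proj_L x + proj_V x = x"
  by (simp add: proj_V_def)

lemma decompose: obtains l v where "l \<in> L" "v \<in> V" "x = l + v"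
  using proj_sum[of x] proj_L_in proj_V_in by metis

text \<open>
  An isometry of \<open>V\<close> over \<open>L\<close> that preserves \<open>tau\<close> is multiplicative because the product of two
  elements of \<open>V\<close> is determined by its pairings with \<open>L\<close> and \<open>V\<close>.
\<close>

lemma extend_to_aut:
  assumes gV: "\<And>v. v \<in> V \<Longrightarrow> g v \<in> V"
    and add: "\<And>u v. u \<in> V \<Longrightarrow> v \<in> V \<Longrightarrow> g (u + v) = g u + g v"
    and g_L: "\<And>l v. l \<in> L \<Longrightarrow> v \<in> V \<Longrightarrow> g (l \<star> v) = l \<star> g v"
    and g_B: "\<And>u v. u \<in> V \<Longrightarrow> v \<in> V \<Longrightarrow> B (g u) (g v) = B u v"
    and g_tau: "\<And>u v w. u \<in> V \<Longrightarrow> v \<in> V \<Longrightarrow> w \<in> V \<Longrightarrow> tau (g u) (g v) (g w) = tau u v w"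
  obtains f where "aut f" "\<forall>l\<in>L. f l = l" "\<forall>v\<in>V. f v = g v"
proof -
  define f where "f x = proj_L x + g (proj_V x)" for x
  have f_eq: "f (l + v) = l + g v" if "l \<in> L" "v \<in> V" for l v
    using that by (simp add: f_def proj_unique)
  have g_0: "g 0 = 0" using g_L[of 0 0] by simp
  have f_L: "f l = l" if "l \<in> L" for l using f_eq[of l 0] that by (simp add: g_0)
  have f_V: "f v = g v" if "v \<in> V" for v using f_eq[of 0 v] that by simp
  have f_add: "f (x + z) = f x + f z" for x z
  proof (rule decompose[of x], rule decompose[of z])
    fix l v m w assume *: "l \<in> L" "v \<in> V" "x = l + v" "m \<in> L" "w \<in> V" "z = m + w"
    have "f (x + z) = f ((l + m) + (v + w))" by (simp add: * algebra_simps)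
    also have "\<dots> = (l + m) + (g v + g w)" using * by (subst f_eq) (simp_all add: add)
    finally show ?thesis using * by (simp add: f_eq algebra_simps)
  qed
  have f_L_mult: "f (l \<star> x) = l \<star> f x" if "l \<in> L" for l x
  proof (rule decompose[of x])
    fix m v assume "m \<in> L" "v \<in> V" "x = m + v"
    then show ?thesis using that by (simp add: pr_linear f_eq g_L)
  qed
  have f_scale: "f (a *s x) = a *s f x" for a x
    using f_L_mult[of "a *s e" x] by (simp add: pr_linear unit_left)
  have f_B: "B (f x) (f z) = B x z" for x z
  proof (rule decompose[of x], rule decompose[of z])
    fix l v m w assume "l \<in> L" "v \<in> V" "x = l + v" "m \<in> L" "w \<in> V" "z = m + w"
    then show ?thesis by (simp add: f_eq B_linear gV g_B)
  qed
  \<comment> \<open>An isometry of a nondegenerate form is injective, and finite dimension then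
    gives surjectivity.\<close>
  have inj: "x = z" if "f x = f z" for x z
  proof (rule eq_of_B)
    fix w
    show "B x w = B z w" using f_B[of x w] f_B[of z w] that by simp
  qed
  have lin: "Vector_Spaces.linear (*s) (*s) f" by (rule linearI) (simp_all add: f_add f_scale)
  obtain T where "finite T" "independent T" "span T = UNIV"
    using finite_spanning_set by blast
  then interpret fd: finite_dimensional_vector_space scale T by unfold_locales auto
  have "inj f" using inj by (auto simp: inj_def)
  then have "surj f" by (rule fd.linear_inj_imp_surj[OF lin])
  then have surj: "\<exists>z. x = f z" for x by (metis surjD)
  have f_V_V: "f (u \<star> v) = g u \<star> g v" if u: "u \<in> V" and v: "v \<in> V" for u v
  proof (rule eq_of_B)
    fix z
    obtain z' where z: "z = f z'" using surj by blast
    obtain n s where ns: "n \<in> L" "s \<in> V" "z' = n + s" by (rule decompose)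
    \<comment> \<open>Against \<open>n\<close> in \<open>L\<close>, adjoints turn the product into a
      pairing of two vectors of \<open>V\<close>, which \<open>g\<close> preserves. Against
      \<open>g s\<close> the pairing is a value of \<open>tau\<close>.\<close>
    have "B (g u \<star> g v) n = - B (g v) (conj n \<star> g u)"
      using ns u by (simp add: B_adjoint_left conj_V gV V_L pr_linear B_linear)
    also have "\<dots> = - B v (conj n \<star> u)"
      using ns u v by (simp add: g_B flip: g_L)
    also have "\<dots> = B (u \<star> v) n"
      using ns u by (simp add: B_adjoint_left conj_V V_L pr_linear B_linear)
    finally have 1: "B (g u \<star> g v) n = B (u \<star> v) n" .
    have 2: "B (g u \<star> g v) (g s) = B (u \<star> v) s"
      using g_tau[of s u v] ns u v by (simp add: tau_def B_commute)
    have "B (f (u \<star> v)) z = B (u \<star> v) z'" by (simp only: z f_B)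
    then show "B (f (u \<star> v)) z = B (g u \<star> g v) z"
      using ns 1 2 by (simp add: z f_eq B_linear)
  qed
  have f_mult: "f (x \<star> z) = f x \<star> f z" for x z
  proof (rule decompose[of x], rule decompose[of z])
    fix l v m w assume *: "l \<in> L" "v \<in> V" "x = l + v" "m \<in> L" "w \<in> V" "z = m + w"
    \<comment> \<open>The product splits into four blocks; \<open>V_L\<close> rewrites right
      multiplication by \<open>L\<close> as left multiplication by the conjugate.\<close>
    have "f (x \<star> z) = f (l \<star> m) + f (l \<star> w) + f (conj m \<star> v) + f (v \<star> w)"
      using * by (simp add: pr_linear f_add V_L algebra_simps)
    also have "\<dots> = l \<star> m + l \<star> g w + conj m \<star> g v + g v \<star> g w"
      using * by (simp add: f_L f_V f_V_V g_L)
    also have "\<dots> = f x \<star> f z"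
      using * by (simp add: f_eq pr_linear V_L gV algebra_simps)
    finally show ?thesis .
  qed
  have "aut f"
    unfolding algebra_automorphism_def
  proof (intro conjI allI)
    show "bij f" using \<open>inj f\<close> \<open>surj f\<close> by (simp add: bij_def)
    show "Vector_Spaces.linear (*s) (*s) f" by (rule lin)
  qed (simp_all add: f_L f_mult)
  then show thesis by (rule that) (simp_all add: f_L f_V)
qed

lemma det3_scale_column:
  fixes a :: "nat \<Rightarrow> nat \<Rightarrow> 'c"
  assumes "\<And>i j. i < 3 \<Longrightarrow> j < 3 \<Longrightarrow> a i j \<in> L" "l \<in> L"
  shows "det3 (\<lambda>i j. if j = 0 then l \<star> a i j else a i j) = l \<star> det3 a"
proof -
  have "a 0 0 \<in> L" "a 0 1 \<in> L" "a 0 2 \<in> L" "a 1 0 \<in> L" "a 1 1 \<in> L" "a 1 2 \<in> L"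
    "a 2 0 \<in> L" "a 2 1 \<in> L" "a 2 2 \<in> L"
    by (simp_all add: assms)
  then show ?thesis
    using assms(2) by (simp add: det3_def pr_linear L_act_assoc del: One_nat_def)
qed

lemma det3_L [simp]:
  assumes "\<And>i j. i < 3 \<Longrightarrow> j < 3 \<Longrightarrow> a i j \<in> L"
  shows "det3 a \<in> L"
  unfolding det3_def by (intro L_closed L_mult assms) simp_all

text \<open>The scalar \<open>l\<close> is absorbed into column 0. Letting it vary recovers
  identities in \<open>L\<close> from identities in \<open>k\<close>, as in
  \<open>aut_det3\<close>.\<close>

lemma tau_det3_scaled:
  fixes x z :: "nat \<Rightarrow> 'c" and a :: "nat \<Rightarrow> nat \<Rightarrow> 'c"
  assumes x: "\<And>i. i < 3 \<Longrightarrow> x i \<in> V" and a: "\<And>i j. i < 3 \<Longrightarrow> j < 3 \<Longrightarrow> a i j \<in> L" and l: "l \<in> L"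
    and z: "\<And>j. j < 3 \<Longrightarrow> z j = a 0 j \<star> x 0 + a 1 j \<star> x 1 + a 2 j \<star> x 2"
  shows "tau (l \<star> z 0) (z 1) (z 2) = tau (l \<star> det3 a \<star> x 0) (x 1) (x 2)"
proof -
  let ?a = "\<lambda>i j. if j = 0 then l \<star> a i j else a i j"
  have "l \<star> z 0 = ?a 0 0 \<star> x 0 + ?a 1 0 \<star> x 1 + ?a 2 0 \<star> x 2"
    using l by (simp add: z pr_linear L_act_assoc a)
  then have "tau (l \<star> z 0) (z 1) (z 2) = tau (det3 ?a \<star> x 0) (x 1) (x 2)"
    using tau_det3[of x ?a] x a l by (simp add: z)
  then show ?thesis by (simp add: det3_scale_column a l)
qed

text \<open>Here \<open>z\<close> and \<open>w\<close> play the role of the images of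
  \<open>x\<close> and \<open>u\<close> under the map with matrix \<open>a\<close>. Both sides are
  \<open>tau\<close> of a triple scaled by \<open>det3 c\<close>, and \<open>det3 a = e\<close>
  identifies the triples \<open>z\<close> and \<open>x\<close> under \<open>tau\<close>.\<close>

lemma tau_preserved:
  fixes x z u w :: "nat \<Rightarrow> 'c" and a c :: "nat \<Rightarrow> nat \<Rightarrow> 'c"
  assumes x: "\<And>i. i < 3 \<Longrightarrow> x i \<in> V" and a: "\<And>i j. i < 3 \<Longrightarrow> j < 3 \<Longrightarrow> a i j \<in> L"
    and c: "\<And>i j. i < 3 \<Longrightarrow> j < 3 \<Longrightarrow> c i j \<in> L" and det: "det3 a = e"
    and z: "\<And>j. j < 3 \<Longrightarrow> z j = a 0 j \<star> x 0 + a 1 j \<star> x 1 + a 2 j \<star> x 2"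
    and u: "\<And>j. j < 3 \<Longrightarrow> u j = c 0 j \<star> x 0 + c 1 j \<star> x 1 + c 2 j \<star> x 2"
    and w: "\<And>j. j < 3 \<Longrightarrow> w j = c 0 j \<star> z 0 + c 1 j \<star> z 1 + c 2 j \<star> z 2"
  shows "tau (w 0) (w 1) (w 2) = tau (u 0) (u 1) (u 2)"
proof -
  have zV: "z i \<in> V" if "i < 3" for i using that x a by (simp add: z)
  have "tau (e \<star> w 0) (w 1) (w 2) = tau (e \<star> det3 c \<star> z 0) (z 1) (z 2)"
    by (rule tau_det3_scaled) (simp_all add: zV c w)
  also have "\<dots> = tau (e \<star> det3 c \<star> det3 a \<star> x 0) (x 1) (x 2)"
    by (rule tau_det3_scaled) (simp_all add: x a c z)
  also have "\<dots> = tau (e \<star> det3 c \<star> x 0) (x 1) (x 2)"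
    by (simp add: det unit_right)
  also have "\<dots> = tau (e \<star> u 0) (u 1) (u 2)"
    by (rule tau_det3_scaled[symmetric]) (simp_all add: x c u)
  finally show ?thesis by (simp add: unit_left)
qed

end

section \<open>Generators of quadratic etale subalgebras\<close>

context octonion_algebra_not_char_2
begin

text \<open>Completing the square: subtracting half the trace from an element outside
  \<open>span {e}\<close> gives a generator orthogonal to \<open>e\<close>. It is anisotropic
  because otherwise it would lie in the radical of \<open>N\<close> on \<open>M\<close>.\<close>

lemma quadratic_etale_obtain:
  assumes "quadratic_etale_subalgebra scale pr e N M"
  obtains y where "octonion_quadratic scale pr e N y" "M = octonion_quadratic.L scale e y"
proof -
  have M: "subspace M" "e \<in> M" "dim M = 2" "nondegenerate_on N M"
    using assms by (simp_all add: quadratic_etale_subalgebra_def subalgebra_def)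
  have "\<not> M \<subseteq> span {e}"
  proof
    assume "M \<subseteq> span {e}"
    then have "dim M \<le> card {e}" by (rule dim_le_card) simp
    then show False using M(3) by simp
  qed
  then obtain z where z: "z \<in> M" "z \<notin> span {e}" by blast
  define y where "y = z - (B z e / 2) *s e"
  have yM: "y \<in> M" using z M by (simp add: y_def subspace_diff subspace_scale)
  have y_span: "y \<notin> span {e}"
  proof
    assume "y \<in> span {e}"
    then have "y + (B z e / 2) *s e \<in> span {e}"
      by (intro span_add span_scale) (auto intro: span_base)
    then show False using z by (simp add: y_def)
  qed
  have ye: "B y e = 0" by (simp add: y_def B_linear)
  have ind: "independent {y, e}"
    using y_span e_neq_0 by (simp add: independent_insert)
  have card2: "card {y, e} = 2"
    using y_span by (metis card_2_iff insertI1 span_base)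
  have span: "M = span {y, e}"
  proof
    show "span {y, e} \<subseteq> M" using M yM by (intro span_minimal) auto
    obtain T where T: "finite T" "independent T" "span T = UNIV"
      using finite_spanning_set by blast
    then interpret fd: finite_dimensional_vector_space scale T by unfold_locales auto
    show "M \<subseteq> span {y, e}"
      using fd.card_ge_dim_independent[of "{y, e}" M] M(2,3) yM ind card2 by simp
  qed
  then have M_eq: "x \<in> M \<longleftrightarrow> (\<exists>a b. x = a *s e + b *s y)" for x
    by (auto simp: span_insert algebra_simps span_singleton) (metis add.commute)+
  have "N y \<noteq> 0"
  proof
    assume "N y = 0"
    have "\<forall>x\<in>M. B y x = 0"
      using ye \<open>N y = 0\<close> by (auto simp: M_eq B_linear B_self)
    then have "y = 0" using M(4) yM by (simp add: nondegenerate_on_def)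
    then show False using y_span by (simp add: span_zero)
  qed
  then interpret octonion_quadratic scale pr e N y using ye by unfold_locales
  show thesis
    by (rule that[of y]) (use M_eq in \<open>auto simp: L_def octonion_quadratic_axioms\<close>)
qed

end

section \<open>The unitary case\<close>

text \<open>The six permutations appear as the products of transpositions produced by the recursion
  over \<open>insert\<close>; both notions of determinant are expanded this way.\<close>

lemma sum_permutes_3:
  "(\<Sum>p | p permutes {0..<3::nat}. f p) =
     f id + f (transpose 1 2) + f (transpose 0 1) + f (transpose 0 1 \<circ> transpose 1 2)
     + f (transpose 0 2) + (f (transpose 0 2 \<circ> transpose 1 2) :: 'a::ab_group_add)"
proof -
  have "{0..<3::nat} = insert 0 (insert 1 (insert 2 {}))" by auto
  then show ?thesis
    by (simp add: sum_over_permutations_insert permutes_empty add.assoc del: One_nat_def)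
qed

lemma transpose_012:
  "transpose 0 (1::nat) 2 = 2" "transpose 0 (2::nat) 1 = 1" "transpose (1::nat) 2 0 = 0"
  by (simp_all add: transpose_def)

lemma finsum_eq_sum:
  fixes R :: "('a::ab_group_add, 'r) ring_scheme"
  assumes "abelian_monoid R" "add R = (+)" "zero R = 0" "finite A" "\<And>i. i \<in> A \<Longrightarrow> g i \<in> carrier R"
  shows "finsum R g A = sum g A"
proof -
  interpret abelian_monoid R by (rule assms)
  show ?thesis
    using assms(4,5)
  proof (induction A)
    case (insert x A)
    then show ?case by (simp add: Pi_def assms(2,3))
  qed (simp add: assms(3))
qed

lemma a_inv_eq_uminus:
  fixes R :: "('a::ab_group_add, 'r) ring_scheme"
  assumes "abelian_group R" "add R = (+)" "zero R = 0" "x \<in> carrier R" "- x \<in> carrier R"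
  shows "\<ominus>\<^bsub>R\<^esub> x = - x"
proof -
  interpret abelian_group R by (rule assms)
  show ?thesis by (rule minus_equality) (simp_all add: assms)
qed

lemma (in cring) finprod_3:
  assumes "\<And>i. i < 3 \<Longrightarrow> g i \<in> carrier R"
  shows "finprod R g {0..<3::nat} = g 0 \<otimes> g 1 \<otimes> g 2"
proof -
  have "{0..<3::nat} = insert 0 (insert 1 (insert 2 {}))" by auto
  moreover have "g 0 \<in> carrier R" "g 1 \<in> carrier R" "g 2 \<in> carrier R" using assms by simp_all
  ultimately show ?thesis
    by (simp add: Pi_def m_assoc del: One_nat_def)
qed

section \<open>\<open>L\<close> as a commutative ring and \<open>V\<close> as a module over
  it\<close>

context octonion_quadratic
begin

abbreviation K :: "'c ring" where "K \<equiv> subalgebra_ring pr e L"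

definition V_mod :: "('c, 'c) module" where
  "V_mod = \<lparr>carrier = V, mult = pr, one = e, zero = 0, add = (+), Module.module.smult = pr\<rparr>"

lemma K_simps [simp]:
  "carrier K = L" "mult K = pr" "one K = e" "zero K = 0" "add K = (+)"
  by (simp_all add: subalgebra_ring_def)

lemma V_mod_simps [simp]:
  "carrier V_mod = V" "zero V_mod = 0" "add V_mod = (+)" "Module.module.smult V_mod = pr"
  by (simp_all add: V_mod_def)

lemma L_assoc: "l \<in> L \<Longrightarrow> m \<in> L \<Longrightarrow> n \<in> L \<Longrightarrow> l \<star> m \<star> n = l \<star> (m \<star> n)"
  by (simp add: L_act_assoc)

lemma L_left_commute:
  assumes "l \<in> L" "m \<in> L" "n \<in> L"
  shows "l \<star> (m \<star> n) = m \<star> (l \<star> n)"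
  using L_assoc[of l m n] L_assoc[of m l n] L_commute[of l m] assms by metis

lemmas L_ac = L_assoc L_commute L_left_commute

lemma cring_K: "cring K"
proof (rule cringI)
  show "abelian_group K"
  proof (rule abelian_groupI)
    fix x assume "x \<in> carrier K"
    then show "\<exists>y\<in>carrier K. y \<oplus>\<^bsub>K\<^esub> x = \<zero>\<^bsub>K\<^esub>" by (intro bexI[of _ "- x"]) simp_all
  qed (simp_all add: add.assoc add.commute)
  show "comm_monoid K"
    by (rule comm_monoidI) (simp_all add: unit_left L_act_assoc, simp only: L_commute)
qed (simp add: pr_linear)

lemma abelian_group_V_mod: "abelian_group V_mod"
proof (rule abelian_groupI)
  fix x assume "x \<in> carrier V_mod"
  then show "\<exists>y\<in>carrier V_mod. y \<oplus>\<^bsub>V_mod\<^esub> x = \<zero>\<^bsub>V_mod\<^esub>"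
    by (intro bexI[of _ "- x"]) simp_all
qed (simp_all add: add.assoc add.commute)

lemma module_V_mod: "Module.module K V_mod"
  by (rule moduleI) (simp_all add: cring_K abelian_group_V_mod pr_linear L_act_assoc unit_left)

lemma finsum_K: "finite A \<Longrightarrow> (\<And>i. i \<in> A \<Longrightarrow> g i \<in> L) \<Longrightarrow> finsum K g A = sum g A"
  using cring_K by (intro finsum_eq_sum) (simp_all add: cring_def ring_def abelian_group_def)

lemma finsum_V_mod: "finite A \<Longrightarrow> (\<And>i. i \<in> A \<Longrightarrow> g i \<in> V) \<Longrightarrow> finsum V_mod g A = sum g A"
  using abelian_group_V_mod by (intro finsum_eq_sum) (simp_all add: abelian_group_def)

lemma a_inv_K: "l \<in> L \<Longrightarrow> \<ominus>\<^bsub>K\<^esub> l = - l"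
  using cring_K by (intro a_inv_eq_uminus) (simp_all add: cring_def ring_def)

lemma finprod_K_3: "(\<And>i. i < 3 \<Longrightarrow> g i \<in> L) \<Longrightarrow> finprod K g {0..<3::nat} = g 0 \<star> g 1 \<star> g 2"
  using cring.finprod_3[OF cring_K, of g] by simp

text \<open>The Leibniz products are ordered by row and those of \<open>det3\<close> by column;
  commutativity of \<open>L\<close> reconciles them.\<close>

lemma Leibniz_det3:
  assumes a: "\<And>i j. i < 3 \<Longrightarrow> j < 3 \<Longrightarrow> a i j \<in> L"
  shows "(\<Oplus>\<^bsub>K\<^esub>p\<in>{p. p permutes {0..<3}}.
      if evenperm p then (\<Otimes>\<^bsub>K\<^esub>i\<in>{0..<3}. a i (p i)) else \<ominus>\<^bsub>K\<^esub> (\<Otimes>\<^bsub>K\<^esub>i\<in>{0..<3}. a i (p i))) = det3 a"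
    (is "finsum K ?f _ = _")
proof -
  define g where "g p = (if evenperm p then a 0 (p 0) \<star> a 1 (p 1) \<star> a 2 (p 2)
    else - (a 0 (p 0) \<star> a 1 (p 1) \<star> a 2 (p 2)))" for p
  have aL: "a 0 0 \<in> L" "a 0 1 \<in> L" "a 0 2 \<in> L" "a 1 0 \<in> L" "a 1 1 \<in> L" "a 1 2 \<in> L"
    "a 2 0 \<in> L" "a 2 1 \<in> L" "a 2 2 \<in> L"
    by (simp_all add: a)
  have in_L: "a i (p i) \<in> L" if "p permutes {0..<3}" "i < 3" for p i
    using that permutes_in_image[OF that(1), of i] by (intro a) auto
  have f_g: "?f p = g p \<and> g p \<in> L" if "p permutes {0..<3}" for p
    using in_L[OF that] by (simp add: g_def finprod_K_3 a_inv_K)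
  have "finsum K ?f {p. p permutes {0..<3}} = sum ?f {p. p permutes {0..<3}}"
    using f_g by (intro finsum_K) (auto simp: finite_permutations)
  also have "\<dots> = sum g {p. p permutes {0..<3}}"
    using f_g by (intro sum.cong) auto
  also have "\<dots> = det3 a"
    unfolding sum_permutes_3
    by (simp add: g_def evenperm_comp evenperm_swap permutation_swap_id transpose_012 det3_def
        del: One_nat_def)
      (use aL in \<open>simp add: L_ac del: One_nat_def\<close>)
  finally show ?thesis .
qed

text \<open>For \<open>l = a *s e + b *s y\<close> the product \<open>l \<star> conj l\<close> is
  \<open>a\<^sup>2 + N y * b\<^sup>2\<close> times \<open>e\<close>; if this scalar vanished for
  nonzero \<open>l\<close>, then \<open>a / b\<close> would be a square root of
  \<open>- N y\<close>.\<close>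

lemma y_square_not_square_field:
  assumes "\<nexists>c. c\<^sup>2 = - N y"
  shows "field K"
proof (rule cring.cring_fieldI2[OF cring_K])
    show "\<zero>\<^bsub>K\<^esub> \<noteq> \<one>\<^bsub>K\<^esub>" using e_neq_0 by simp
    fix l assume "l \<in> carrier K" "l \<noteq> \<zero>\<^bsub>K\<^esub>"
    then obtain a b where l: "l = a *s e + b *s y" "l \<noteq> 0" by (auto elim: LE)
    have "a\<^sup>2 + N y * b\<^sup>2 \<noteq> 0"
    proof
      assume *: "a\<^sup>2 + N y * b\<^sup>2 = 0"
      show False
      proof (cases "b = 0")
        case True
        then show False using * l by simp
      next
        case False
        then have "(a / b)\<^sup>2 = - N y"
          using * by (simp add: power_divide field_simps eq_neg_iff_add_eq_0)
        then show False using assms by blast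
      qed
    qed
    moreover have "l \<star> conj l = (a\<^sup>2 + N y * b\<^sup>2) *s e"
      by (simp add: l conj_L_eq pr_linear unit_left unit_right algebra_simps power2_eq_square)
    ultimately have "l \<star> ((1 / (a\<^sup>2 + N y * b\<^sup>2)) *s conj l) = e"
      by (simp add: pr_linear)
    moreover have "conj l \<in> L" by (simp add: l)
    ultimately show "\<exists>m\<in>carrier K. l \<otimes>\<^bsub>K\<^esub> m = \<one>\<^bsub>K\<^esub>"
      by (intro bexI[of _ "(1 / (a\<^sup>2 + N y * b\<^sup>2)) *s conj l"]) simp_all
qed

end

section \<open>Determinants of automorphisms fixing \<open>L\<close>\<close>

context octonion_frame
begin

text \<open>Every index from 2 on gives \<open>v3\<close>, so that \<open>frame_in\<close> holds
  without a bound on the index.\<close>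

definition frame :: "nat \<Rightarrow> 'c" where
  "frame i = (if i = 0 then v1 else if i = 1 then v2 else v3)"

lemma frame_simps [simp]: "frame 0 = v1" "frame 1 = v2" "frame (Suc 0) = v2" "frame 2 = v3"
  by (simp_all add: frame_def)

lemma frame_in [simp]: "frame i \<in> V"
  by (simp add: frame_def)

text \<open>Since \<open>v1\<close> and \<open>v2\<close> anticommute,
  \<open>v2 \<star> v3 = N v2 *s v1\<close>. As \<open>m\<close> varies, the value thus determines
  multiples of \<open>v1\<close> by \<open>L\<close>.\<close>

lemma tau_frame: "tau (m \<star> v1) v2 v3 = N v1 * N v2 * B m e"
proof -
  have "v1 \<star> v2 = - (v2 \<star> v1)"
    using conj_mult_left_linear[of v1 v2 e] B_v1_v2
    by (simp add: conj_V unit_right eq_neg_iff_add_eq_0 pr_linear neg_eq_iff_add_eq_0)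
  then have "v2 \<star> v3 = N v2 *s v1"
    using conj_mult_left_cancel[of v2 v1] by (simp add: v3_def conj_V pr_linear)
  then show ?thesis
    using B_mult_right[of m v1 e] by (simp add: tau_def B_linear unit_left)
qed

text \<open>An automorphism preserves \<open>tau\<close> and also multiplies it by
  \<open>det3 a\<close>. Comparing the two for every scalar \<open>conj n\<close> in front
  determines \<open>det3 a\<close> by nondegeneracy on \<open>L\<close>.\<close>

lemma aut_det3:
  assumes f: "aut f" "\<forall>l\<in>L. f l = l"
    and a: "\<And>i j. i < 3 \<Longrightarrow> j < 3 \<Longrightarrow> a i j \<in> L"
    and f_a: "\<And>j. j < 3 \<Longrightarrow> f (frame j) = a 0 j \<star> v1 + a 1 j \<star> v2 + a 2 j \<star> v3"
  shows "det3 a = e"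
proof (rule L_eqI)
  fix n assume n: "n \<in> L"
  have "tau (conj n \<star> f v1) (f v2) (f v3) = tau (f (conj n \<star> v1)) (f v2) (f v3)"
    using aut_L_mult[OF f] n by simp
  also have "\<dots> = N v1 * N v2 * B (conj n) e"
    using f by (simp add: aut_tau tau_frame)
  finally have 1: "tau (conj n \<star> f v1) (f v2) (f v3) = N v1 * N v2 * B (conj n) e" .
  have "tau (conj n \<star> f v1) (f v2) (f v3) = tau (conj n \<star> det3 a \<star> v1) v2 v3"
    using tau_det3_scaled[of frame a "conj n" "\<lambda>j. f (frame j)"] n a f_a by simp
  then have "B (conj n \<star> det3 a) e = B (conj n) e"
    using 1 by (simp add: tau_frame)
  then show "B (det3 a) n = B e n"
    using B_conj_conj[of e n]
    by (simp add: B_adjoint_left[of "conj n" "det3 a"] B_commute[of "conj n"] unit_right)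
qed (simp_all add: a)

end

lemma sum_3: "sum g {0..<3::nat} = g 0 + g 1 + (g 2 :: 'a::comm_monoid_add)"
  by (simp add: numeral_3_eq_3 numeral_2_eq_2)

section \<open>The automorphism group and its pointwise stabilizers\<close>

context composition_algebra_not_char_2
begin

lemma carrier_aut_group: "f \<in> carrier (aut_group scale pr e) \<longleftrightarrow> aut f"
  by (simp add: aut_group_def)

lemma aut_in_Bij: "aut f \<Longrightarrow> f \<in> Bij UNIV"
  by (simp add: Bij_def autD)

lemma mult_aut_group: "aut f \<Longrightarrow> aut g \<Longrightarrow> f \<otimes>\<^bsub>aut_group scale pr e\<^esub> g = f \<circ> g"
  by (simp add: aut_group_def BijGroup_def aut_in_Bij compose_def fun_eq_iff)

lemma aut_comp: assumes "aut f" "aut g" shows "aut (f \<circ> g)"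
  unfolding algebra_automorphism_def
proof (intro conjI allI)
  show "bij (f \<circ> g)" using assms by (simp add: bij_comp autD)
  show "Vector_Spaces.linear scale scale (f \<circ> g)"
    by (rule linearI) (simp_all add: autD[OF assms(1)] autD[OF assms(2)])
qed (simp_all add: autD[OF assms(1)] autD[OF assms(2)])

lemma aut_id: "aut id"
  unfolding algebra_automorphism_def by (auto intro: linearI)

lemma aut_fixing_iff: "f \<in> aut_fixing scale pr e M \<longleftrightarrow> aut f \<and> (\<forall>l\<in>M. f l = l)"
  by (simp add: aut_fixing_def carrier_aut_group)

lemma one_aut_group: "\<one>\<^bsub>aut_group scale pr e\<^esub> = id"
  by (simp add: aut_group_def BijGroup_def fun_eq_iff)

lemma group_aut_group: "group (aut_group scale pr e)"
proof (rule groupI)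
  fix f assume "f \<in> carrier (aut_group scale pr e)"
  then have f: "aut f" by (simp add: carrier_aut_group)
  have "inv_into UNIV f \<circ> f = id" using autD(1)[OF f] by (simp add: bij_is_inj)
  then show "\<exists>g\<in>carrier (aut_group scale pr e). g \<otimes>\<^bsub>aut_group scale pr e\<^esub> f = \<one>\<^bsub>aut_group scale pr e\<^esub>"
    using f aut_inv[OF f] by (intro bexI[of _ "inv_into UNIV f"])
      (simp_all add: carrier_aut_group mult_aut_group one_aut_group)
qed (simp_all add: carrier_aut_group mult_aut_group one_aut_group aut_comp aut_id comp_assoc)

lemma subgroup_aut_fixing: "subgroup (aut_fixing scale pr e M) (aut_group scale pr e)"
proof (rule group.subgroupI[OF group_aut_group])
  show "aut_fixing scale pr e M \<noteq> {}"
    using aut_id aut_fixing_iff[of id M] by auto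
  fix f assume f: "f \<in> aut_fixing scale pr e M"
  then have aut: "aut f" by (simp add: aut_fixing_iff)
  have "inv_into UNIV f \<circ> f = id" using autD(1)[OF aut] by (simp add: bij_is_inj)
  then have "m_inv (aut_group scale pr e) f = inv_into UNIV f"
    using aut aut_inv[OF aut]
    by (intro group.inv_equality[OF group_aut_group])
      (simp_all add: carrier_aut_group mult_aut_group one_aut_group)
  moreover have "inv_into UNIV f l = l" if "l \<in> M" for l
    using f that autD(1)[OF aut] by (metis aut_fixing_iff bij_is_inj inv_f_f)
  ultimately show "m_inv (aut_group scale pr e) f \<in> aut_fixing scale pr e M"
    using aut_inv[OF aut] by (simp add: aut_fixing_iff)
qed (auto simp: aut_fixing_iff carrier_aut_group mult_aut_group aut_comp)

end

section \<open>The hermitian space \<open>V\<close> and its special unitary group\<close>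

context octonion_frame
begin

lemma vectorspace_V_mod: "field K \<Longrightarrow> vectorspace K V_mod"
  by (simp add: vectorspace_def module_V_mod)

lemma lincomb_3:
  assumes "inj_on b {0..<3::nat}" "\<And>i. i < 3 \<Longrightarrow> b i \<in> V" "\<And>i. i < 3 \<Longrightarrow> a (b i) \<in> L"
  shows "module.lincomb V_mod a (b ` {0..<3}) = a (b 0) \<star> b 0 + a (b 1) \<star> b 1 + a (b 2) \<star> b 2"
proof -
  have "module.lincomb V_mod a (b ` {0..<3}) = (\<Sum>v\<in>b ` {0..<3}. a v \<star> v)"
    unfolding module.lincomb_def[OF module_V_mod]
    using assms by (subst finsum_V_mod) auto
  also have "\<dots> = (\<Sum>i = 0..<3. a (b i) \<star> b i)"
    using assms(1) by (simp add: sum.reindex)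
  finally show ?thesis by (simp add: sum_3 del: One_nat_def)
qed

lemma inj_frame: "inj_on frame {0..<3}"
proof (rule inj_onI)
  have ne: "v1 \<noteq> v2" "v1 \<noteq> v3" "v2 \<noteq> v3"
    using h_frame e_neq_0 by (metis N_v1 N_v2 scale_eq_0_iff)+
  fix i j :: nat assume "i \<in> {0..<3}" "j \<in> {0..<3}" "frame i = frame j"
  moreover have "i = 0 \<or> i = 1 \<or> i = 2" "j = 0 \<or> j = 1 \<or> j = 2" using calculation by auto
  ultimately show "i = j" using ne by (auto simp: frame_def)
qed

lemma h_frame_comb:
  assumes "l \<in> L" "m \<in> L" "n \<in> L"
  shows "h (l \<star> v1 + m \<star> v2 + n \<star> v3) v1 = N v1 *s l"
    "h (l \<star> v1 + m \<star> v2 + n \<star> v3) v2 = N v2 *s m"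
    "h (l \<star> v1 + m \<star> v2 + n \<star> v3) v3 = N v3 *s n"
  using assms by (simp_all add: h_add h_L_mult h_frame pr_linear unit_right)

text \<open>Existence of coordinates is \<open>frame_expansion\<close>; uniqueness follows by
  applying \<open>h\<close> against each frame vector.\<close>

lemma basis_frame:
  assumes "field K"
  shows "vectorspace.basis K V_mod (frame ` {0..<3})"
proof -
  note vs = vectorspace_V_mod[OF assms]
  have comb: "module.lincomb V_mod a (frame ` {0..<3}) =
      a v1 \<star> v1 + a v2 \<star> v2 + a v3 \<star> v3"
    if "a \<in> frame ` {0..<3} \<rightarrow> L" for a
  proof -
    have "a (frame i) \<in> L" if "i < 3" for i using that \<open>a \<in> _\<close> by auto
    then show ?thesis using lincomb_3[OF inj_frame, of a] by simp
  qed
  have "{0..<3::nat} = {0, 1, 2}" by auto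
  then have image: "frame ` {0..<3} = {v1, v2, v3}" by simp
  have ex1: "\<exists>!a. a \<in> frame ` {0..<3} \<rightarrow>\<^sub>E L \<and> module.lincomb V_mod a (frame ` {0..<3}) = v"
    if v: "v \<in> V" for v
  proof (rule ex1I)
    \<comment> \<open>Uniqueness is among functions that are \<open>undefined\<close> off the frame,
      hence the restriction.\<close>
    let ?a = "restrict (coord v) (frame ` {0..<3})"
    have "?a \<in> frame ` {0..<3} \<rightarrow>\<^sub>E L" by simp
    moreover have "module.lincomb V_mod ?a (frame ` {0..<3}) = v"
      using frame_expansion[OF v] by (subst comb) (simp_all add: image)
    ultimately show "?a \<in> frame ` {0..<3} \<rightarrow>\<^sub>E L \<and> module.lincomb V_mod ?a (frame ` {0..<3}) = v"
      by blast
    fix a assume a: "a \<in> frame ` {0..<3} \<rightarrow>\<^sub>E L \<and> module.lincomb V_mod a (frame ` {0..<3}) = v"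
    then have aL: "a v1 \<in> L" "a v2 \<in> L" "a v3 \<in> L" by (auto simp: image)
    have "v = a v1 \<star> v1 + a v2 \<star> v2 + a v3 \<star> v3"
      using a comb[of a] by (auto simp: PiE_def)
    then have "a v1 = coord v v1" "a v2 = coord v v2" "a v3 = coord v v3"
      using h_frame_comb[OF aL] by (simp_all add: coord_def)
    then show "a = ?a" using a by (auto simp: image fun_eq_iff PiE_def extensional_def)
  qed
  show ?thesis
    unfolding vectorspace.basis_criterion[OF vs, of "frame ` {0..<3}", simplified]
    using ex1 by (subst vectorspace.basis_criterion[OF vs]) auto
qed

lemma dim_V_mod:
  assumes "field K"
  shows "vectorspace.fin_dim K V_mod" "vectorspace.dim K V_mod = 3"
proof -
  note vs = vectorspace_V_mod[OF assms] and b = basis_frame[OF assms]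
  show "vectorspace.fin_dim K V_mod"
    unfolding vectorspace.fin_dim_def[OF vs]
    using b unfolding vectorspace.basis_def[OF vs] by (intro exI[of _ "frame ` {0..<3}"]) simp
  show "vectorspace.dim K V_mod = 3"
    using vectorspace.dim_basis[OF vs _ b] card_image[OF inj_frame] by simp
qed

lemma rank_hermitian_space_V_mod:
  assumes "field K"
  shows "rank_hermitian_space K V_mod conj h 3"
proof -
  note vs = vectorspace_V_mod[OF assms]
  have "hermitian_space K V_mod conj h"
  proof (intro hermitian_space.intro[OF vs] hermitian_space_axioms.intro)
    show "conj \<in> ring_iso K K"
    proof (rule ring_iso_memI)
      show "bij_betw conj (carrier K) (carrier K)"
        by (rule bij_betwI[of _ _ _ conj]) auto
    qed (simp_all add: conj_linear conj_mult, simp only: L_commute conj_L)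
    fix x assume x: "x \<in> carrier V_mod" "\<And>y. y \<in> carrier V_mod \<Longrightarrow> h x y = \<zero>\<^bsub>K\<^esub>"
    \<comment> \<open>A vector in the radical of \<open>h\<close> on \<open>V\<close> is orthogonal
      to \<open>V\<close>, and it is orthogonal to \<open>L\<close> because it lies in
      \<open>V\<close>.\<close>
    have "B x w = B 0 w" for w
    proof (rule decompose[of w])
      fix l v assume *: "l \<in> L" "v \<in> V" "w = l + v"
      then have "h x v = 0" using x(2)[of v] by simp
      then show ?thesis using * x(1) by (simp add: B_linear h_eq_0_iff)
    qed
    then show "x = \<zero>\<^bsub>V_mod\<^esub>" using eq_of_B[of x 0] by simp
  qed (simp_all add: h_add h_L_mult, simp only: h_commute[symmetric])
  then show ?thesis
    using dim_V_mod[OF assms]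
    by (simp add: rank_hermitian_space_def rank_hermitian_space_axioms_def)
qed

lemma carrier_SU: "g \<in> carrier (SU K V_mod h) \<longleftrightarrow>
   g \<in> extensional V \<and> bij_betw g V V \<and> g \<in> LinearCombinations.module_hom K V_mod V_mod \<and>
   (\<forall>x\<in>V. \<forall>w\<in>V. h (g x) (g w) = h x w) \<and> has_determinant K V_mod g e"
  by (auto simp: SU_def Bij_def)

text \<open>Elements of \<open>SU\<close> are \<open>undefined\<close> off \<open>V\<close>, hence
  the restriction. The determinant is witnessed in the basis \<open>frame\<close>, where
  \<open>aut_det3\<close> computes it.\<close>

lemma restrict_aut_SU:
  assumes K: "field K" and f: "aut f" "\<forall>l\<in>L. f l = l"
  shows "restrict f V \<in> carrier (SU K V_mod h)"
  unfolding carrier_SU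
proof (intro conjI ballI)
  show "bij_betw (restrict f V) V V"
    using aut_bij_V[OF f] by (simp add: bij_betw_restrict_eq)
  show "restrict f V \<in> LinearCombinations.module_hom K V_mod V_mod"
    unfolding LinearCombinations.module_hom_def
    using f aut_V[OF f] aut_L_mult[OF f] by (auto simp: autD)
  show "has_determinant K V_mod (restrict f V) e"
    unfolding has_determinant_def
  proof (intro exI conjI allI impI)
    let ?a = "\<lambda>i j. coord (f (frame j)) (frame i)"
    show "inj_on frame {0..<3}" by (rule inj_frame)
    show "vectorspace.basis K V_mod (frame ` {0..<3})" by (rule basis_frame[OF K])
    show "?a i j \<in> carrier K" for i j by simp
    have f_a: "f (frame j) = ?a 0 j \<star> v1 + ?a 1 j \<star> v2 + ?a 2 j \<star> v3" for j
      using frame_expansion[OF aut_V[OF f frame_in]] by simp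
    show "restrict f V (frame j) = (\<Oplus>\<^bsub>V_mod\<^esub>i\<in>{0..<3}. ?a i j \<odot>\<^bsub>V_mod\<^esub> frame i)" for j
      using f_a[of j] by (simp add: finsum_V_mod sum_3 del: One_nat_def)
    have "det3 ?a = e" by (rule aut_det3[OF f _ f_a]) simp
    then show "e = (\<Oplus>\<^bsub>K\<^esub>p\<in>{p. p permutes {0..<3}}. if evenperm p
        then \<Otimes>\<^bsub>K\<^esub>i\<in>{0..<3}. ?a i (p i) else \<ominus>\<^bsub>K\<^esub> (\<Otimes>\<^bsub>K\<^esub>i\<in>{0..<3}. ?a i (p i)))"
      by (subst Leibniz_det3) simp_all
  qed
qed (simp_all add: aut_h[OF f])

text \<open>The determinant condition supplies some basis \<open>b\<close>, which need not be
  \<open>frame\<close> or orthogonal. Invariance of \<open>tau\<close> is therefore proved in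
  coordinates with respect to \<open>b\<close>, and \<open>extend_to_aut\<close> applies.\<close>

lemma SU_extends_to_aut:
  assumes K: "field K" and g: "g \<in> carrier (SU K V_mod h)"
  obtains f where "aut f" "\<forall>l\<in>L. f l = l" "restrict f V = g"
proof -
  note vs = vectorspace_V_mod[OF K]
  have ext: "g \<in> extensional V" and bij: "bij_betw g V V"
    and hom: "g \<in> LinearCombinations.module_hom K V_mod V_mod"
    and h: "\<And>x w. x \<in> V \<Longrightarrow> w \<in> V \<Longrightarrow> h (g x) (g w) = h x w"
    and det: "has_determinant K V_mod g e"
    using g unfolding carrier_SU by auto
  have gV: "g v \<in> V" if "v \<in> V" for v using bij that by (auto simp: bij_betw_def)
  have add: "g (u + v) = g u + g v" if "u \<in> V" "v \<in> V" for u v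
    using module_hom_add[OF hom, of u v] that by simp
  have g_L: "g (l \<star> v) = l \<star> g v" if "l \<in> L" "v \<in> V" for l v
    using module_hom_smult[OF hom, of l v] that by simp
  have B: "B (g u) (g v) = B u v" if "u \<in> V" "v \<in> V" for u v
    using h[OF that] B_h[of e "g u" "g v"] B_h[of e u v] by (simp add: unit_left)
  obtain n :: nat and b a where *: "inj_on b {0..<n} \<and> vectorspace.basis K V_mod (b ` {0..<n}) \<and>
      (\<forall>i<n. \<forall>j<n. a i j \<in> carrier K) \<and>
      (\<forall>j<n. g (b j) = (\<Oplus>\<^bsub>V_mod\<^esub>i\<in>{0..<n}. a i j \<odot>\<^bsub>V_mod\<^esub> b i)) \<and>
      e = (\<Oplus>\<^bsub>K\<^esub>p\<in>{p. p permutes {0..<n}}. if evenperm p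
        then \<Otimes>\<^bsub>K\<^esub>i\<in>{0..<n}. a i (p i) else \<ominus>\<^bsub>K\<^esub> (\<Otimes>\<^bsub>K\<^esub>i\<in>{0..<n}. a i (p i)))"
    using det unfolding has_determinant_def by (elim exE)
  then have b: "inj_on b {0..<n}" "vectorspace.basis K V_mod (b ` {0..<n})"
    and a: "\<And>i j. i < n \<Longrightarrow> j < n \<Longrightarrow> a i j \<in> L"
    and g_b: "\<And>j. j < n \<Longrightarrow> g (b j) = (\<Oplus>\<^bsub>V_mod\<^esub>i\<in>{0..<n}. a i j \<odot>\<^bsub>V_mod\<^esub> b i)"
    and d: "e = (\<Oplus>\<^bsub>K\<^esub>p\<in>{p. p permutes {0..<n}}. if evenperm p
        then \<Otimes>\<^bsub>K\<^esub>i\<in>{0..<n}. a i (p i) else \<ominus>\<^bsub>K\<^esub> (\<Otimes>\<^bsub>K\<^esub>i\<in>{0..<n}. a i (p i)))"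
    by simp_all
  \<comment> \<open>The size of the witnessing basis is left open by \<open>has_determinant\<close>;
    the dimension of \<open>V\<close> fixes it.\<close>
  have n: "n = 3"
    using vectorspace.dim_basis[OF vs _ b(2)] dim_V_mod(2)[OF K] card_image[OF b(1)] by simp
  note b = b[unfolded n] and a = a[unfolded n] and g_b = g_b[unfolded n] and d = d[unfolded n]
  have bV: "b i \<in> V" if "i < 3" for i
    using b(2) that unfolding vectorspace.basis_def[OF vs] by auto
  have det3: "det3 a = e" using d a by (simp add: Leibniz_det3)
  have ex_coords: "\<exists>c :: nat \<Rightarrow> 'c. (\<forall>i<3. c i \<in> L) \<and> u = c 0 \<star> b 0 + c 1 \<star> b 1 + c 2 \<star> b 2" if "u \<in> V" for u
  proof -
    have "b ` {0..<3} \<subseteq> carrier V_mod" using bV by auto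
    then have "\<forall>v. v \<in> V \<longrightarrow> (\<exists>!c. c \<in> b ` {0..<3} \<rightarrow>\<^sub>E L \<and> module.lincomb V_mod c (b ` {0..<3}) = v)"
      using b(2) vectorspace.basis_criterion[OF vs, of "b ` {0..<3}"] by simp
    then obtain c where c: "c \<in> b ` {0..<3} \<rightarrow>\<^sub>E L" "module.lincomb V_mod c (b ` {0..<3}) = u"
      using \<open>u \<in> V\<close> by blast
    show ?thesis
    proof (intro exI[of _ "\<lambda>i. c (b i)"] conjI allI impI)
      show in_L: "c (b i) \<in> L" if "i < 3" for i using that c(1) by auto
      show "u = c (b 0) \<star> b 0 + c (b 1) \<star> b 1 + c (b 2) \<star> b 2"
        using lincomb_3[OF b(1), of c] bV in_L c(2) by simp
    qed
  qed
  have tau: "tau (g u0) (g u1) (g u2) = tau u0 u1 u2" if u: "u0 \<in> V" "u1 \<in> V" "u2 \<in> V" for u0 u1 u2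
  proof -
    obtain c0 :: "nat \<Rightarrow> 'c" where c0: "\<forall>i<3. c0 i \<in> L" "u0 = c0 0 \<star> b 0 + c0 1 \<star> b 1 + c0 2 \<star> b 2"
      using ex_coords[OF u(1)] by blast
    obtain c1 :: "nat \<Rightarrow> 'c" where c1: "\<forall>i<3. c1 i \<in> L" "u1 = c1 0 \<star> b 0 + c1 1 \<star> b 1 + c1 2 \<star> b 2"
      using ex_coords[OF u(2)] by blast
    obtain c2 :: "nat \<Rightarrow> 'c" where c2: "\<forall>i<3. c2 i \<in> L" "u2 = c2 0 \<star> b 0 + c2 1 \<star> b 1 + c2 2 \<star> b 2"
      using ex_coords[OF u(3)] by blast
    define u where "u j = (if j = 0 then u0 else if j = 1 then u1 else u2)" for j :: nat
    define c where "c i j = (if j = 0 then c0 i else if j = 1 then c1 i else c2 i)" for i j :: nat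
    have cL: "c i j \<in> L" if "i < 3" for i j using that c0 c1 c2 by (simp add: c_def)
    have u_c: "u j = c 0 j \<star> b 0 + c 1 j \<star> b 1 + c 2 j \<star> b 2" for j
      by (simp add: u_def c_def c0(2) c1(2) c2(2) del: One_nat_def)
    have "tau (g (u 0)) (g (u 1)) (g (u 2)) = tau (u 0) (u 1) (u 2)"
    proof (rule tau_preserved[of b a c "\<lambda>j. g (b j)" u "\<lambda>j. g (u j)"])
      show "g (b j) = a 0 j \<star> b 0 + a 1 j \<star> b 1 + a 2 j \<star> b 2" if "j < 3" for j
      proof -
        have "finsum V_mod (\<lambda>i. a i j \<star> b i) {0..<3} = (\<Sum>i = 0..<3. a i j \<star> b i)"
          by (rule finsum_V_mod) (use a bV that in auto)
        then show ?thesis using g_b[OF that] by (simp add: sum_3 del: One_nat_def)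
      qed
      show "g (u j) = c 0 j \<star> g (b 0) + c 1 j \<star> g (b 1) + c 2 j \<star> g (b 2)" for j
        by (simp add: u_c add g_L bV cL del: One_nat_def)
    qed (use bV a cL det3 u_c in \<open>blast+\<close>)
    then show ?thesis by (simp add: u_def)
  qed
  show thesis
  proof (rule extend_to_aut[of g])
    fix f assume f: "aut f" "\<forall>l\<in>L. f l = l" "\<forall>v\<in>V. f v = g v"
    then have "restrict f V = g"
      by (intro extensionalityI[OF restrict_extensional ext]) simp
    with f show thesis using that by blast
  qed (simp_all add: gV add g_L B tau)
qed

text \<open>Restriction to \<open>V\<close> is the isomorphism. It is injective because
  \<open>L\<close> and \<open>V\<close> together span the algebra, and surjective by
  \<open>SU_extends_to_aut\<close>.\<close>

lemma aut_fixing_iso_SU: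
  assumes K: "field K"
  shows "aut_group scale pr e \<lparr>carrier := aut_fixing scale pr e L\<rparr> \<cong> SU K V_mod h"
proof (rule is_isoI)
  let ?G = "aut_group scale pr e \<lparr>carrier := aut_fixing scale pr e L\<rparr>"
  show "(\<lambda>f. restrict f V) \<in> iso ?G (SU K V_mod h)"
  proof (rule isoI)
    show "(\<lambda>f. restrict f V) \<in> hom ?G (SU K V_mod h)"
    proof (rule homI)
      fix f g assume "f \<in> carrier ?G" "g \<in> carrier ?G"
      then have f: "aut f" "\<forall>l\<in>L. f l = l" and g: "aut g" "\<forall>l\<in>L. g l = l"
        by (simp_all add: aut_fixing_iff)
      show "restrict f V \<in> carrier (SU K V_mod h)" by (rule restrict_aut_SU[OF K f])
      have "restrict f V \<in> Bij V" "restrict g V \<in> Bij V"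
        using restrict_aut_SU[OF K f] restrict_aut_SU[OF K g] by (auto simp: SU_def)
      then show "restrict (f \<otimes>\<^bsub>?G\<^esub> g) V = restrict f V \<otimes>\<^bsub>SU K V_mod h\<^esub> restrict g V"
        using f g aut_V[OF g] by (auto simp: mult_aut_group SU_def BijGroup_def compose_def fun_eq_iff)
    qed
    show "bij_betw (\<lambda>f. restrict f V) (carrier ?G) (carrier (SU K V_mod h))"
    proof (rule bij_betw_imageI)
      show "inj_on (\<lambda>f. restrict f V) (carrier ?G)"
      proof (rule inj_onI)
        fix f g assume fg: "f \<in> carrier ?G" "g \<in> carrier ?G" "restrict f V = restrict g V"
        then have f: "aut f" "\<forall>l\<in>L. f l = l" and g: "aut g" "\<forall>l\<in>L. g l = l"
          by (simp_all add: aut_fixing_iff)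
        show "f = g"
        proof
          fix x
          obtain l v where x: "l \<in> L" "v \<in> V" "x = l + v" by (rule decompose)
          then have "f v = g v" using fg(3) by (metis restrict_apply')
          then show "f x = g x" using x f g by (simp add: autD)
        qed
      qed
      show "(\<lambda>f. restrict f V) ` carrier ?G = carrier (SU K V_mod h)"
      proof
        show "(\<lambda>f. restrict f V) ` carrier ?G \<subseteq> carrier (SU K V_mod h)"
          using restrict_aut_SU[OF K] by (auto simp: aut_fixing_iff)
        show "carrier (SU K V_mod h) \<subseteq> (\<lambda>f. restrict f V) ` carrier ?G"
        proof
          fix g assume "g \<in> carrier (SU K V_mod h)"
          then obtain f where "aut f" "\<forall>l\<in>L. f l = l" "restrict f V = g"
            using SU_extends_to_aut[OF K] by blast
          then show "g \<in> (\<lambda>f. restrict f V) ` carrier ?G" by (auto simp: aut_fixing_iff)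
        qed
      qed
    qed
  qed
qed

end

section \<open>The split case\<close>

text \<open>The monomials are listed as in \<open>det3\<close>, so that the two determinants can be
  compared term by term.\<close>

lemma det_3:
  assumes "A \<in> carrier_mat 3 3"
  shows "det A = A $$ (0,0) * A $$ (1,1) * A $$ (2,2) + A $$ (1,0) * A $$ (2,1) * A $$ (0,2)
    + A $$ (2,0) * A $$ (0,1) * A $$ (1,2) - A $$ (2,0) * A $$ (1,1) * A $$ (0,2)
    - A $$ (1,0) * A $$ (0,1) * A $$ (2,2) - A $$ (0,0) * A $$ (2,1) * A $$ (1,2)"
proof -
  have prod: "(\<Prod>i = 0..<3. A $$ (i, p i)) = A $$ (0, p 0) * A $$ (1, p 1) * A $$ (2, p 2)" for p
    by (simp add: numeral_3_eq_3 numeral_2_eq_2)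
  show ?thesis
    unfolding det_def'[OF assms] sum_permutes_3 prod
    by (simp add: sign_compose sign_swap_id permutation_swap_id transpose_012 algebra_simps
        del: One_nat_def)
qed

section \<open>Idempotents of \<open>L\<close> and matrices of automorphisms\<close>

locale split_octonion_frame = octonion_frame scale pr e N y v1 v2
  for scale :: "'k::field \<Rightarrow> 'c::ab_group_add \<Rightarrow> 'c" (infixr "*s" 75)
    and pr :: "'c \<Rightarrow> 'c \<Rightarrow> 'c" (infixl "\<star>" 70) and e :: 'c and N :: "'c \<Rightarrow> 'k"
    and y v1 v2 :: 'c +
  fixes c :: 'k
  assumes c_square: "c * c = - N y"
begin

lemma c_neq_0: "c \<noteq> 0"
  using c_square by auto

text \<open>As \<open>y\<close> divided by \<open>c\<close> squares to \<open>e\<close>, the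
  elements \<open>p\<close> and \<open>q\<close> are the two complementary idempotents of
  \<open>L\<close>.\<close>

definition p :: 'c where "p = (1/2) *s e + (1 / (2 * c)) *s y"

definition q :: 'c where "q = (1/2) *s e + (- 1 / (2 * c)) *s y"

lemma p_q_in_L [simp]: "p \<in> L" "q \<in> L"
  unfolding p_def q_def by (rule L_I)+

lemma p_add_q: "p + q = e"
proof -
  have "p + q = (1/2 + 1/2) *s e + (1 / (2 * c) + - 1 / (2 * c)) *s y"
    unfolding p_def q_def scale_left_distrib by (simp add: algebra_simps)
  then show ?thesis by simp
qed

lemma N_y_c: "N y = - (c * c)"
  using c_square by simp

lemma p_q_comb: "a *s p + b *s q = ((a + b) / 2) *s e + ((a - b) / (2 * c)) *s y"
  by (simp add: p_def q_def add_divide_distrib diff_divide_distrib algebra_simps)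

lemma four_neq_0: "(4::'k) \<noteq> 0"
  using two_neq_0 by (metis mult_2 no_zero_divisors numeral_Bit0)

lemma p_p: "p \<star> p = p" and p_q: "p \<star> q = 0" and q_p: "q \<star> p = 0" and q_q: "q \<star> q = q"
proof -
  have *: "(1/2 * (1/2) - N y * u * v :: 'k) = 1/4 + c * c * u * v" for u v
    by (simp add: N_y_c)
  have quarter: "1 / 4 + 1 / 4 = (1 / 2 :: 'k)" using four_neq_0 by (simp add: field_simps)
  have c4: "1 / (4 * c) + 1 / (4 * c) = 1 / (2 * c)"
    using quarter c_neq_0 four_neq_0 by (simp add: field_simps)
  show "p \<star> p = p" "p \<star> q = 0" "q \<star> p = 0" "q \<star> q = q"
    unfolding p_def q_def L_mult_eq *
    using c_neq_0 quarter c4 by simp_all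
qed

lemma conj_p: "conj p = q" and conj_q: "conj q = p"
  by (simp_all add: p_def q_def conj_linear)

text \<open>\<open>conj\<close> exchanges \<open>p\<close> and \<open>q\<close>, so
  \<open>B p p = B (p \<star> q) e = 0\<close>. Hence \<open>p\<close>, \<open>q\<close> is a
  hyperbolic pair, and \<open>B l q\<close> reads off the \<open>p\<close>-coordinate of
  \<open>l\<close> in \<open>L\<close>.\<close>

lemma B_p_q [simp]: "B p p = 0" "B q q = 0" "B p q = 1" "B q p = 1" "B p e = 1" "B q e = 1"
proof -
  have "B p e = 1" "B q e = 1" by (simp_all add: p_def q_def B_linear)
  moreover have "B p p = B (p \<star> q) e" "B q q = B (q \<star> p) e" "B p q = B (p \<star> p) e" "B q p = B (q \<star> q) e"
    using B_adjoint_right[of p q e] B_adjoint_right[of q p e] B_adjoint_right[of p p e]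
      B_adjoint_right[of q q e]
    by (simp_all add: unit_left conj_p conj_q)
  ultimately show "B p p = 0" "B q q = 0" "B p q = 1" "B q p = 1" "B p e = 1" "B q e = 1"
    by (simp_all add: p_p p_q q_p q_q)
qed

lemma L_eq_p_q:
  assumes "l \<in> L"
  shows "l = B l q *s p + B l p *s q"
proof (rule L_eqI)
  fix n assume "n \<in> L"
  obtain a b where l: "l = a *s e + b *s y" using assms by (metis LE)
  have "l = (a + b * c) *s p + (a - b * c) *s q"
    unfolding p_q_comb l using c_neq_0 by simp
  then show "B l n = B (B l q *s p + B l p *s q) n"
    by (simp add: B_linear)
qed (simp_all add: assms)

lemma p_q_mult: "(a *s p + b *s q) \<star> (a' *s p + b' *s q) = (a * a') *s p + (b * b') *s q"
  by (simp add: pr_linear p_p p_q q_p q_q mult.commute)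

lemma B_mult_q: "l \<in> L \<Longrightarrow> m \<in> L \<Longrightarrow> B (l \<star> m) q = B l q * B m q"
  using p_q_mult[of "B l q" "B l p" "B m q" "B m p"]
  by (simp add: B_linear flip: L_eq_p_q)

lemma p_L_mult: "l \<in> L \<Longrightarrow> p \<star> l = B l q *s p"
  by (subst L_eq_p_q[of l]) (simp_all add: pr_linear p_p p_q)

lemma q_L_mult: "l \<in> L \<Longrightarrow> q \<star> l = B l p *s q"
  by (subst L_eq_p_q[of l]) (simp_all add: pr_linear q_p q_q)

lemma split_quadratic_L: "split_quadratic scale pr e L"
  unfolding split_quadratic_def
proof (intro exI[of _ "\<lambda>x. (B x q, B x p)"] conjI ballI allI)
  have conj_pq: "B (l \<star> m) p = B l p * B m p" if "l \<in> L" "m \<in> L" for l m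
    using p_q_mult[of "B l q" "B l p" "B m q" "B m p"] that
    by (simp add: B_linear flip: L_eq_p_q)
  show "bij_betw (\<lambda>x. (B x q, B x p)) L UNIV"
    by (rule bij_betwI[of _ _ _ "\<lambda>(a, b). a *s p + b *s q"])
      (auto simp: B_linear simp flip: L_eq_p_q)
  show "(B e q, B e p) = (1, 1)" by (simp add: B_commute[of e])
  show "(B (x \<star> z) q, B (x \<star> z) p) =
      (fst (B x q, B x p) * fst (B z q, B z p), snd (B x q, B x p) * snd (B z q, B z p))"
    if "x \<in> L" "z \<in> L" for x z
    using that by (simp add: B_mult_q conj_pq)
qed (simp_all add: B_linear)

lemma frame_cases: "i < 3 \<Longrightarrow> i = 0 \<or> i = 1 \<or> i = (2::nat)"
  by auto

lemma N_frame [simp]: "N (frame i) \<noteq> 0"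
  by (simp add: frame_def)

lemma h_frame_index:
  assumes "i < 3" "j < 3"
  shows "h (frame i) (frame j) = (if i = j then N (frame i) *s e else 0)"
  using frame_cases[OF assms(1)] frame_cases[OF assms(2)] by (auto simp: h_frame)

lemma expansion: "v \<in> V \<Longrightarrow> v = (\<Sum>i = 0..<3. coord v (frame i) \<star> frame i)"
  using frame_expansion[of v] by (simp add: sum_3 del: One_nat_def)

lemma coord_add: "coord (u + v) w = coord u w + coord v w"
  by (simp add: coord_def h_add algebra_simps)

lemma coord_L_mult: "l \<in> L \<Longrightarrow> coord (l \<star> v) w = l \<star> coord v w"
  by (simp add: coord_def h_L_mult pr_linear)

lemma coord_frame:
  assumes "i < 3" "j < 3"
  shows "coord (frame j) (frame i) = (if i = j then e else 0)"
  using assms by (simp add: coord_def h_frame_index)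

text \<open>The \<open>p\<close>-component of the matrix over \<open>L\<close>. For an automorphism
  fixing \<open>L\<close> it describes the action on the multiples of \<open>p\<close>, in terms of
  the vectors \<open>p \<star> frame i\<close>.\<close>

definition matrix_of_aut :: "('c \<Rightarrow> 'c) \<Rightarrow> 'k mat" where
  "matrix_of_aut f = mat 3 3 (\<lambda>(i, j). B (coord (f (frame j)) (frame i)) q)"

lemma matrix_of_aut_carrier [simp]: "matrix_of_aut f \<in> carrier_mat 3 3"
  by (simp add: matrix_of_aut_def)

lemma index_matrix_of_aut:
  "i < 3 \<Longrightarrow> j < 3 \<Longrightarrow> matrix_of_aut f $$ (i, j) = B (coord (f (frame j)) (frame i)) q"
  by (simp add: matrix_of_aut_def)

lemma aut_sum:
  assumes "aut f"
  shows "f (\<Sum>i\<in>I. g i) = (\<Sum>i\<in>I. f (g i))"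
  by (induction I rule: infinite_finite_induct) (simp_all add: autD[OF assms])

lemma coord_sum: "coord (\<Sum>i\<in>I. g i) w = (\<Sum>i\<in>I. coord (g i) w)"
  by (induction I rule: infinite_finite_induct) (simp_all add: coord_add, simp_all add: coord_def h_def)

lemma matrix_of_aut_mult:
  assumes f: "aut f" "\<forall>l\<in>L. f l = l" and g: "aut g" "\<forall>l\<in>L. g l = l"
  shows "matrix_of_aut (f \<circ> g) = matrix_of_aut f * matrix_of_aut g"
proof (rule eq_matI)
  fix i j assume "i < dim_row (matrix_of_aut f * matrix_of_aut g)"
    "j < dim_col (matrix_of_aut f * matrix_of_aut g)"
  then have ij: "i < 3" "j < 3" by (simp_all add: matrix_of_aut_def)
  have "f (g (frame j)) = f (\<Sum>k = 0..<3. coord (g (frame j)) (frame k) \<star> frame k)"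
    using expansion[OF aut_V[OF g frame_in]] by simp
  also have "\<dots> = (\<Sum>k = 0..<3. coord (g (frame j)) (frame k) \<star> f (frame k))"
    by (simp add: aut_sum[OF f(1)] aut_L_mult[OF f])
  finally have "coord (f (g (frame j))) (frame i) =
      (\<Sum>k = 0..<3. coord (g (frame j)) (frame k) \<star> coord (f (frame k)) (frame i))"
    by (simp add: coord_sum coord_L_mult)
  then have "B (coord (f (g (frame j))) (frame i)) q =
      (\<Sum>k = 0..<3. B (coord (g (frame j)) (frame k)) q * B (coord (f (frame k)) (frame i)) q)"
    by (simp add: B_sum_left B_mult_q)
  then show "matrix_of_aut (f \<circ> g) $$ (i, j) = (matrix_of_aut f * matrix_of_aut g) $$ (i, j)"
    using ij by (simp add: matrix_of_aut_def scalar_prod_def mult.commute)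
qed (simp_all add: matrix_of_aut_def)

text \<open>On \<open>L\<close>, the map \<open>B l q\<close> is a ring homomorphism to
  \<open>k\<close>; it carries \<open>det3\<close> to \<open>det\<close> and \<open>e\<close> to
  1.\<close>

lemma det_matrix_of_aut:
  assumes f: "aut f" "\<forall>l\<in>L. f l = l"
  shows "det (matrix_of_aut f) = 1"
proof -
  let ?a = "\<lambda>i j. coord (f (frame j)) (frame i)"
  have f_a: "f (frame j) = ?a 0 j \<star> v1 + ?a 1 j \<star> v2 + ?a 2 j \<star> v3" for j
    using frame_expansion[OF aut_V[OF f frame_in]] by simp
  have "det3 ?a = e" by (rule aut_det3[OF f _ f_a]) simp
  then have "B (det3 ?a) q = 1" by (simp add: B_commute[of e])
  then show ?thesis
    unfolding det_3[OF matrix_of_aut_carrier]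
    by (simp add: index_matrix_of_aut det3_def B_linear B_mult_q del: One_nat_def)
qed

text \<open>The matrix determines the action on \<open>p \<star> v\<close> for \<open>v\<close> in
  \<open>V\<close>. The vectors \<open>q \<star> v\<close> are dual to these under \<open>B\<close>,
  so an isometry has no freedom left on them.\<close>

lemma matrix_of_aut_inj:
  assumes f: "aut f" "\<forall>l\<in>L. f l = l" and g: "aut g" "\<forall>l\<in>L. g l = l"
    and eq: "matrix_of_aut f = matrix_of_aut g"
  shows "f = g"
proof -
  have p_f: "p \<star> f (frame j) = (\<Sum>i = 0..<3. matrix_of_aut f $$ (i, j) *s (p \<star> frame i))"
    if "j < 3" and f: "aut f" "\<forall>l\<in>L. f l = l" for j f
  proof -
    have "p \<star> f (frame j) = p \<star> (\<Sum>i = 0..<3. coord (f (frame j)) (frame i) \<star> frame i)"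
      using expansion[OF aut_V[OF f frame_in]] by simp
    also have "\<dots> = (\<Sum>i = 0..<3. p \<star> (coord (f (frame j)) (frame i) \<star> frame i))"
      by (simp add: sum_3 pr_linear)
    also have "\<dots> = (\<Sum>i = 0..<3. matrix_of_aut f $$ (i, j) *s (p \<star> frame i))"
      using that(1) by (intro sum.cong) (simp_all add: L_act_assoc p_L_mult pr_linear index_matrix_of_aut)
    finally show ?thesis .
  qed
  have p_eq: "f (p \<star> v) = g (p \<star> v)" if v: "v \<in> V" for v
  proof -
    have *: "f' (p \<star> v) = (\<Sum>j = 0..<3. coord v (frame j) \<star> (p \<star> f' (frame j)))"
      if f': "aut f'" "\<forall>l\<in>L. f' l = l" for f'
    proof -
      have "f' (p \<star> v) = p \<star> f' (\<Sum>j = 0..<3. coord v (frame j) \<star> frame j)"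
        using expansion[OF v] aut_L_mult[OF f', of p v] by simp
      also have "\<dots> = p \<star> (\<Sum>j = 0..<3. coord v (frame j) \<star> f' (frame j))"
        by (simp only: aut_sum[OF f'(1)] aut_L_mult[OF f' coord_L])
      also have "\<dots> = (\<Sum>j = 0..<3. p \<star> (coord v (frame j) \<star> f' (frame j)))"
        by (simp add: sum_3 pr_linear)
      also have "\<dots> = (\<Sum>j = 0..<3. coord v (frame j) \<star> (p \<star> f' (frame j)))"
        by (intro sum.cong) (simp_all add: L_act_assoc, simp add: L_commute[of p])
      finally show ?thesis .
    qed
    show ?thesis
      unfolding *[OF f] *[OF g] using p_f[OF _ f] p_f[OF _ g] eq by (intro sum.cong) simp_all
  qed
  have q_eq: "f (q \<star> v) = g (q \<star> v)" if v: "v \<in> V" for v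
  proof -
    \<comment> \<open>The difference \<open>d\<close> is shown to be orthogonal to \<open>L\<close>,
      to the images of the \<open>q\<close>-part and to the images of the \<open>p\<close>-part,
      where \<open>f\<close> and \<open>g\<close> agree; these span the algebra.\<close>
    define d where "d = f (q \<star> v) - g (q \<star> v)"
    have d: "d \<in> V" "q \<star> d = d"
      using v aut_V[OF f] aut_V[OF g] aut_L_mult[OF f, of q] aut_L_mult[OF g, of q]
      by (simp_all add: d_def pr_linear L_act_assoc q_q)
    have "B d z = B 0 z" for z
    proof -
      obtain w where z: "z = f w" using autD(1)[OF f(1)] by (metis bij_pointE)
      obtain l u where w: "l \<in> L" "u \<in> V" "w = l + u" by (rule decompose)
      have "u = p \<star> u + q \<star> u" by (simp add: p_add_q unit_left flip: pr_add_left)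
      from arg_cong[OF this, of f] have "f u = f (p \<star> u) + f (q \<star> u)"
        by (simp only: autD(5)[OF f(1)])
      then have "z = l + f (p \<star> u) + f (q \<star> u)"
        using w f(2) by (simp add: z autD(5)[OF f(1)] add.assoc)
      moreover have "B d l = 0" using d w by simp
      moreover have "B d (f (q \<star> u)) = 0"
      proof -
        \<comment> \<open>The \<open>q\<close>-part is totally isotropic: the pairing is a multiple
          of \<open>B q q\<close>, which is 0.\<close>
        have "B d (f (q \<star> u)) = B (q \<star> d) (q \<star> f u)"
          using aut_L_mult[OF f, of q u] d by simp
        also have "\<dots> = B (q \<star> h d (f u)) q" by (rule B_L_mult_h) simp_all
        also have "\<dots> = 0" by (simp add: q_L_mult B_linear)
        finally show ?thesis .
      qed
      moreover have "B d (f (p \<star> u)) = 0"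
        using p_eq[OF w(2)] aut_B[OF f(1), of "q \<star> v" "p \<star> u"] aut_B[OF g(1), of "q \<star> v" "p \<star> u"]
        by (simp add: d_def B_linear)
      ultimately show ?thesis by (simp add: B_linear)
    qed
    then have "d = 0" by (rule eq_of_B)
    then show ?thesis by (simp add: d_def)
  qed
  show "f = g"
  proof
    fix x
    obtain l u where x: "l \<in> L" "u \<in> V" "x = l + u" by (rule decompose)
    have "f (p \<star> u + q \<star> u) = g (p \<star> u + q \<star> u)"
      using p_eq[OF x(2)] q_eq[OF x(2)] by (simp add: autD(5)[OF f(1)] autD(5)[OF g(1)])
    then have "f u = g u" by (simp add: p_add_q unit_left flip: pr_add_left)
    then show "f x = g x" using x f g by (simp add: autD)
  qed
qed

text \<open>
  The action on \<open>p V\<close> is prescribed by \<open>A\<close>; being an isometry forces the contragredient action \<open>C\<close> on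
  \<open>q V\<close>, where the norms appear because the frame is orthogonal but not orthonormal.
\<close>

lemma ex_aut_of_matrix:
  assumes A: "A \<in> carrier_mat 3 3" "det A = 1"
  shows "\<exists>f. aut f \<and> (\<forall>l\<in>L. f l = l) \<and> matrix_of_aut f = A"
proof -
  \<comment> \<open>Because \<open>det A = 1\<close>, the adjugate is the inverse of
    \<open>A\<close>; the norm ratios are chosen so that \<open>orth\<close> holds.\<close>
  define C where "C k j = (N (frame j) / N (frame k)) * adj_mat A $$ (j, k)" for k j
  define a where "a k j = A $$ (k, j) *s p + C k j *s q" for k j
  define z where "z j = (\<Sum>k = 0..<3. a k j \<star> frame k)" for j
  define g where "g v = (\<Sum>j = 0..<3. coord v (frame j) \<star> z j)" for v
  have one: "1 \<cdot>\<^sub>m 1\<^sub>m 3 = (1\<^sub>m 3 :: 'k mat)" by (rule eq_matI) simp_all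
  have adj: "adj_mat A \<in> carrier_mat 3 3" "A * adj_mat A = 1\<^sub>m 3" "adj_mat A * A = 1\<^sub>m 3"
    using adj_mat[OF A(1)] A(2) one by simp_all
  have aL [simp]: "a k j \<in> L" for k j by (simp add: a_def)
  have zV [simp]: "z j \<in> V" for j by (simp add: z_def sum_3)
  have orth: "(\<Sum>k = 0..<3. N (frame k) * (A $$ (k, i) * C k j)) = (if i = j then N (frame j) else 0)"
    if "i < 3" "j < 3" for i j
  proof -
    have "(\<Sum>k = 0..<3. N (frame k) * (A $$ (k, i) * C k j)) =
        N (frame j) * (\<Sum>k = 0..<3. adj_mat A $$ (j, k) * A $$ (k, i))"
      unfolding sum_distrib_left by (intro sum.cong) (simp_all add: C_def)
    also have "(\<Sum>k = 0..<3. adj_mat A $$ (j, k) * A $$ (k, i)) = (adj_mat A * A) $$ (j, i)"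
      using that A(1) adj(1) by (simp add: scalar_prod_def)
    finally show ?thesis using that by (simp add: adj(3))
  qed
  have h_right: "h x (l \<star> w) = conj l \<star> h x w" if "l \<in> L" for x w l
    using that by (simp add: h_commute[of x] h_L_mult conj_mult, simp add: L_commute)
  have h_add_right: "h x (w + w') = h x w + h x w'" for x w w'
    by (simp add: h_commute[of x] h_add conj_linear)
  \<comment> \<open>Used both for \<open>frame\<close> and for \<open>z\<close>: two families with
    the same Gram matrix give the same values of \<open>h\<close>, so \<open>g\<close> is an
    isometry.\<close>
  have h_sum: "h (\<Sum>i = 0..<3. l i \<star> x i) (\<Sum>j = 0..<3. m j \<star> x j) =
      (\<Sum>i = 0..<3. N (frame i) *s (l i \<star> conj (m i)))"
    if "\<And>i j. i < 3 \<Longrightarrow> j < 3 \<Longrightarrow> h (x i) (x j) = (if i = j then N (frame i) *s e else 0)"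
      "\<And>i. l i \<in> L" "\<And>i. m i \<in> L" for l m x :: "nat \<Rightarrow> 'c"
    by (simp add: sum_3 h_add h_add_right h_L_mult h_right that pr_linear unit_right del: One_nat_def,
        simp add: that L_commute[of "conj (m _)" "l _"] del: One_nat_def)
  have h_z: "h (z i) (z j) = (if i = j then N (frame i) *s e else 0)" if "i < 3" "j < 3" for i j
  proof -
    have "h (z i) (z j) = (\<Sum>k = 0..<3. N (frame k) *s (a k i \<star> conj (a k j)))"
      unfolding z_def by (rule h_sum) (simp_all add: h_frame_index)
    also have "\<dots> = (\<Sum>k = 0..<3. (N (frame k) * (A $$ (k, i) * C k j)) *s p
        + (N (frame k) * (A $$ (k, j) * C k i)) *s q)"
    proof (rule sum.cong[OF refl])
      fix k
      \<comment> \<open>As \<open>conj\<close> exchanges \<open>p\<close> and \<open>q\<close>, each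
        component of \<open>h (z i) (z j)\<close> pairs \<open>A\<close> with \<open>C\<close>, and
        \<open>orth\<close> evaluates both.\<close>
      have "conj (a k j) = C k j *s p + A $$ (k, j) *s q"
        by (simp add: a_def conj_linear conj_p conj_q add.commute)
      then show "N (frame k) *s (a k i \<star> conj (a k j)) = (N (frame k) * (A $$ (k, i) * C k j)) *s p
        + (N (frame k) * (A $$ (k, j) * C k i)) *s q"
        unfolding a_def[of k i] by (simp add: p_q_mult scale_right_distrib mult.commute)
    qed
    also have "\<dots> = (\<Sum>k = 0..<3. N (frame k) * (A $$ (k, i) * C k j)) *s p
        + (\<Sum>k = 0..<3. N (frame k) * (A $$ (k, j) * C k i)) *s q"
      by (simp only: sum.distrib scale_sum_left)
    also have "\<dots> = (if i = j then N (frame i) *s (p + q) else 0)"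
      using that by (simp add: orth scale_right_distrib)
    finally show ?thesis by (simp add: p_add_q)
  qed
  have "det (adj_mat A) * det A = 1"
    using det_mult[OF adj(1) A(1)] by (simp add: adj(3))
  then have det_adj: "det (adj_mat A) = 1" using A(2) by simp
  \<comment> \<open>Each monomial runs over a permutation, so the norm ratios cancel and the
    determinant of the transposed adjugate remains.\<close>
  have det_C: "C 0 0 * C 1 1 * C 2 2 + C 1 0 * C 2 1 * C 0 2 + C 2 0 * C 0 1 * C 1 2
      - C 2 0 * C 1 1 * C 0 2 - C 1 0 * C 0 1 * C 2 2 - C 0 0 * C 2 1 * C 1 2 = 1"
    using det_adj unfolding det_3[OF adj(1)] by (simp add: C_def algebra_simps del: One_nat_def)
  have det3: "det3 a = e"
  proof -
    have "det3 a = det A *s p + (C 0 0 * C 1 1 * C 2 2 + C 1 0 * C 2 1 * C 0 2 + C 2 0 * C 0 1 * C 1 2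
        - C 2 0 * C 1 1 * C 0 2 - C 1 0 * C 0 1 * C 2 2 - C 0 0 * C 2 1 * C 1 2) *s q"
      unfolding det_3[OF A(1)] det3_def a_def p_q_mult
      by (simp add: scale_left_distrib scale_left_diff_distrib del: One_nat_def)
    then show ?thesis by (simp only: det_C A(2) scale_one p_add_q)
  qed
  have g_add: "g (u + v) = g u + g v" for u v
    by (simp add: g_def coord_add pr_linear sum.distrib)
  have g_L: "g (l \<star> v) = l \<star> g v" if "l \<in> L" for l v
    using that by (simp add: g_def coord_L_mult sum_3 pr_linear L_act_assoc)
  have g_B: "B (g u) (g v) = B u v" if "u \<in> V" "v \<in> V" for u v
  proof -
    have "h (g u) (g v) = (\<Sum>i = 0..<3. N (frame i) *s (coord u (frame i) \<star> conj (coord v (frame i))))"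
      unfolding g_def by (rule h_sum) (simp_all add: h_z)
    also have "\<dots> = h (\<Sum>i = 0..<3. coord u (frame i) \<star> frame i) (\<Sum>i = 0..<3. coord v (frame i) \<star> frame i)"
      by (rule h_sum[symmetric]) (simp_all add: h_frame_index)
    also have "\<dots> = h u v"
      by (simp only: expansion[OF that(1), symmetric] expansion[OF that(2), symmetric])
    finally have "h (g u) (g v) = h u v" .
    then show ?thesis using B_h[of e "g u" "g v"] B_h[of e u v] by (simp add: unit_left)
  qed
  have g_tau: "tau (g u0) (g u1) (g u2) = tau u0 u1 u2" if u: "u0 \<in> V" "u1 \<in> V" "u2 \<in> V" for u0 u1 u2
  proof -
    define u where "u j = (if j = 0 then u0 else if j = 1 then u1 else u2)" for j :: nat
    have uV: "u j \<in> V" for j using u by (simp add: u_def)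
    have "tau (g (u 0)) (g (u 1)) (g (u 2)) = tau (u 0) (u 1) (u 2)"
    proof (rule tau_preserved[of frame a "\<lambda>i j. coord (u j) (frame i)" z u "\<lambda>j. g (u j)"])
      show "z j = a 0 j \<star> frame 0 + a 1 j \<star> frame 1 + a 2 j \<star> frame 2" for j
        by (simp only: z_def sum_3)
      show "u j = coord (u j) (frame 0) \<star> frame 0 + coord (u j) (frame 1) \<star> frame 1
          + coord (u j) (frame 2) \<star> frame 2" for j
        by (rule expansion[OF uV, unfolded sum_3])
      show "g (u j) = coord (u j) (frame 0) \<star> z 0 + coord (u j) (frame 1) \<star> z 1
          + coord (u j) (frame 2) \<star> z 2" for j
        by (simp only: g_def sum_3)
    qed (simp_all add: det3)
    then show ?thesis by (simp add: u_def)
  qed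
  show ?thesis
  proof (rule extend_to_aut[of g])
    fix f assume f: "aut f" "\<forall>l\<in>L. f l = l" "\<forall>v\<in>V. f v = g v"
    have "matrix_of_aut f = A"
    proof (rule eq_matI)
      fix i j assume "i < dim_row A" "j < dim_col A"
      then have ij: "i < 3" "j < 3" using A by simp_all
      \<comment> \<open>The coordinates of \<open>frame j\<close> are \<open>e\<close> and 0, so
        \<open>g\<close> sends it to \<open>z j\<close>, whose coordinates have column
        \<open>j\<close> of \<open>A\<close> as \<open>p\<close>-components.\<close>
      have "g (frame j) = (\<Sum>k = 0..<3. if k = j then z j else 0)"
        unfolding g_def using ij by (intro sum.cong) (simp_all add: coord_frame unit_left)
      then have "g (frame j) = z j" using ij by simp
      then have "coord (f (frame j)) (frame i) = coord (z j) (frame i)" using f by simp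
      also have "\<dots> = (\<Sum>k = 0..<3. if k = i then a i j else 0)"
        unfolding z_def coord_sum using ij
        by (intro sum.cong) (simp_all add: coord_L_mult coord_frame unit_right)
      finally have "coord (f (frame j)) (frame i) = a i j" using ij by simp
      then show "matrix_of_aut f $$ (i, j) = A $$ (i, j)"
        using ij by (simp add: index_matrix_of_aut a_def B_linear)
    qed (use A in \<open>simp_all add: matrix_of_aut_def\<close>)
    with f show ?thesis by blast
  qed (simp_all add: g_add g_L g_B g_tau, simp add: g_def sum_3)
qed

lemma aut_fixing_iso_SL:
  "aut_group scale pr e \<lparr>carrier := aut_fixing scale pr e L\<rparr> \<cong> SL TYPE('k) 3"
proof (rule is_isoI)
  let ?G = "aut_group scale pr e \<lparr>carrier := aut_fixing scale pr e L\<rparr>"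
  show "matrix_of_aut \<in> iso ?G (SL TYPE('k) 3)"
  proof (rule isoI)
    show "matrix_of_aut \<in> hom ?G (SL TYPE('k) 3)"
      by (rule homI) (auto simp: aut_fixing_iff SL_def det_matrix_of_aut mult_aut_group matrix_of_aut_mult)
    show "bij_betw matrix_of_aut (carrier ?G) (carrier (SL TYPE('k) 3))"
    proof (rule bij_betw_imageI)
      show "inj_on matrix_of_aut (carrier ?G)"
        by (rule inj_onI) (auto simp: aut_fixing_iff intro: matrix_of_aut_inj)
      show "matrix_of_aut ` carrier ?G = carrier (SL TYPE('k) 3)"
      proof
        show "matrix_of_aut ` carrier ?G \<subseteq> carrier (SL TYPE('k) 3)"
          by (auto simp: aut_fixing_iff SL_def det_matrix_of_aut)
        show "carrier (SL TYPE('k) 3) \<subseteq> matrix_of_aut ` carrier ?G"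
        proof
          fix A assume "A \<in> carrier (SL TYPE('k) 3)"
          then have "A \<in> carrier_mat 3 3" "det A = 1" by (simp_all add: SL_def)
          then obtain f where "aut f" "\<forall>l\<in>L. f l = l" "matrix_of_aut f = A"
            using ex_aut_of_matrix by blast
          then show "A \<in> matrix_of_aut ` carrier ?G" by (auto simp: aut_fixing_iff)
        qed
      qed
    qed
  qed
qed

end

section \<open>Recognition of the split case and conclusion\<close>

context octonion_quadratic
begin

text \<open>Applying \<phi> to \<open>y \<star> y = - (N y *s e)\<close> shows that the first
  component of the image of \<open>y\<close> squares to \<open>- N y\<close>.\<close>

lemma ex_square_root_of_split:
  assumes "split_quadratic scale pr e L"
  shows "\<exists>c. c * c = - N y"
proof -
  obtain \<phi> :: "'c \<Rightarrow> 'k \<times> 'k" where \<phi>: "\<phi> e = (1, 1)"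
    "\<And>x z. x \<in> L \<Longrightarrow> z \<in> L \<Longrightarrow> \<phi> (x \<star> z) = (fst (\<phi> x) * fst (\<phi> z), snd (\<phi> x) * snd (\<phi> z))"
    "\<And>a x. x \<in> L \<Longrightarrow> \<phi> (a *s x) = (a * fst (\<phi> x), a * snd (\<phi> x))"
    using assms unfolding split_quadratic_def by blast
  have "fst (\<phi> (y \<star> y)) = fst (\<phi> ((- N y) *s e))" by (simp only: y_y scale_minus_left)
  then have "fst (\<phi> y) * fst (\<phi> y) = - N y"
    by (simp only: \<phi>(2)[OF y_in_L y_in_L] \<phi>(1,3) e_in_L fst_conv mult_1_right)
  then show ?thesis by blast
qed

end

theorem lemma6p1:
  fixes scale :: "'k::field \<Rightarrow> 'c::ab_group_add \<Rightarrow> 'c"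
    and pr :: "'c \<Rightarrow> 'c \<Rightarrow> 'c" and e :: 'c and N :: "'c \<Rightarrow> 'k" and t0 :: "'c \<Rightarrow> 'c"
  assumes "CHAR('k) \<noteq> 2"
    and "octonion_algebra scale pr e N"
    and "t0 \<in> carrier (aut_group scale pr e)"
    and "semisimple_endomorphism scale t0"
  shows
    "((\<exists>Q. quaternion_subalgebra scale pr e N Q \<and> t0 ` Q = Q) \<or>
      (\<exists>L. quadratic_etale_subalgebra scale pr e N L \<and> (\<forall>x\<in>L. t0 x = x))) \<and>
     (\<forall>L. quadratic_etale_subalgebra scale pr e N L \<and> (\<forall>x\<in>L. t0 x = x) \<longrightarrow>
        subgroup (aut_fixing scale pr e L) (aut_group scale pr e) \<and>
        t0 \<in> aut_fixing scale pr e L \<and>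
        (field (subalgebra_ring pr e L) \<or> split_quadratic scale pr e L) \<and>
        (field (subalgebra_ring pr e L) \<longrightarrow>
           (\<exists>(V :: ('c, 'c) module) h.
              rank_hermitian_space (subalgebra_ring pr e L) V (conjugation scale e N) h 3 \<and>
              aut_group scale pr e \<lparr>carrier := aut_fixing scale pr e L\<rparr>
                \<cong> SU (subalgebra_ring pr e L) V h)) \<and>
        (split_quadratic scale pr e L \<longrightarrow>
           aut_group scale pr e \<lparr>carrier := aut_fixing scale pr e L\<rparr> \<cong> SL TYPE('k) 3))"
proof -
  interpret octonion_algebra scale pr e N by (rule assms(2))
  \<comment> \<open>A zero unit would make the whole algebra zero, against
    \<open>dim_8\<close>.\<close>
  have "e \<noteq> 0"
  proof
    assume "e = 0"
    have "x = 0" for x :: 'c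
    proof -
      have "pr (0 + 0) x = pr 0 x + pr 0 x"
        using linear_left[of x]
        unfolding Vector_Spaces.linear_def Modules.module_hom_def Modules.module_hom_axioms_def by blast
      then show ?thesis using unit_left[of x] \<open>e = 0\<close> by simp
    qed
    then have "dim UNIV \<le> card ({} :: 'c set)"
      by (intro dim_le_card) auto
    then show False using dim_8 by simp
  qed
  then interpret octonion_algebra_not_char_2 scale pr e N
    by unfold_locales (rule assms(1))
  have t0: "aut t0" using assms(3) by (simp add: carrier_aut_group)
  have "\<exists>L. quadratic_etale_subalgebra scale pr e N L \<and> (\<forall>x\<in>L. t0 x = x)"
  proof -
    obtain y where y: "t0 y = y" "B y e = 0" "N y \<noteq> 0"
      using ex_fixed_anisotropic[OF t0 assms(4)] by blast
    then interpret octonion_quadratic scale pr e N y by unfold_locales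
    have "\<forall>x\<in>L. t0 x = x" using y(1) by (auto simp: L_def autD[OF t0])
    with quadratic_etale_L show ?thesis by blast
  qed
  moreover have "subgroup (aut_fixing scale pr e M) (aut_group scale pr e) \<and>
        t0 \<in> aut_fixing scale pr e M \<and>
        (field (subalgebra_ring pr e M) \<or> split_quadratic scale pr e M) \<and>
        (field (subalgebra_ring pr e M) \<longrightarrow>
           (\<exists>(V :: ('c, 'c) module) h.
              rank_hermitian_space (subalgebra_ring pr e M) V (conjugation scale e N) h 3 \<and>
              aut_group scale pr e \<lparr>carrier := aut_fixing scale pr e M\<rparr>
                \<cong> SU (subalgebra_ring pr e M) V h)) \<and>
        (split_quadratic scale pr e M \<longrightarrow>
           aut_group scale pr e \<lparr>carrier := aut_fixing scale pr e M\<rparr> \<cong> SL TYPE('k) 3)"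
    if M: "quadratic_etale_subalgebra scale pr e N M" "\<forall>x\<in>M. t0 x = x" for M
  proof -
    obtain y where "octonion_quadratic scale pr e N y" and M_eq: "M = octonion_quadratic.L scale e y"
      using quadratic_etale_obtain[OF M(1)] by blast
    then interpret octonion_quadratic scale pr e N y by blast
    obtain v1 v2 where "octonion_frame scale pr e N y v1 v2" using ex_frame by blast
    then interpret octonion_frame scale pr e N y v1 v2 .
    have split: "split_octonion_frame scale pr e N y v1 v2 c" if "c * c = - N y" for c
      using that by unfold_locales
    \<comment> \<open>The two cases correspond to whether \<open>- N y\<close> is a square in
      \<open>k\<close>.\<close>
    have "field K \<or> split_quadratic scale pr e L"
      using y_square_not_square_field split split_octonion_frame.split_quadratic_L
      by (metis power2_eq_square)
    moreover have "aut_group scale pr e \<lparr>carrier := aut_fixing scale pr e L\<rparr> \<cong> SL TYPE('k) 3"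
      if "split_quadratic scale pr e L"
      using ex_square_root_of_split[OF that] split split_octonion_frame.aut_fixing_iso_SL by blast
    ultimately show ?thesis
      using M(2) t0 subgroup_aut_fixing rank_hermitian_space_V_mod aut_fixing_iso_SU
      unfolding M_eq by (auto simp: aut_fixing_iff)
  qed
  ultimately show ?thesis by blast
qed

end
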